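(* Let $(X,\sigma)$ and $(T,\tau)$ be torsion-free Toeplitz subshifts with scales $(p_n)$ and $(q_n)$ respectively. If $\operatorname{Aut}^{(\infty)}(X,\sigma)$ and $\operatorname{Aut}^{(\infty)}(T,\tau)$ are isomorphic as groups, then $(p_n)$ is equivalent to $(q_n)$, i.e. $\mathbf{v}_p((p_n))=\mathbf{v}_p((q_n))$ for every prime $p$.
   Context: Let $\mathcal{A}$ be a finite alphabet and $\sigma$ the left shift on $\mathcal{A}^{\mathbb{Z}}$. A Toeplitz sequence $u$ is one such that for every $n\in\mathbb{Z}$ there is $m\ge1$ with $u_n=u_{n+km}$ for all $k$; it is assumed non-periodic. With $\operatorname{per}_p(u)=\{k: u_k=u_{k+pm}\ \forall m\}$, a period structure of $u$ is a sequence $(p_n)$ with $p_n\mid p_{n+1}$, $\bigcup_n\operatorname{per}_{p_n}(u)=\mathbb{Z}$, and each $p_n$ essential (for $1\le p<p_n$, $\operatorname{per}_p(u)\neq\operatorname{per}_{p_n}(u)$). The Toeplitz subshift is the orbit closure of $u$ with the shift; its scale here means the period structure of $u$. For a prime $p$, $\mathbf{v}_p((p_n))=\lim_n\nu_p(p_n)\in\mathbb{N}\cup\{0,\infty\}$ where $\nu_p$ is the $p$-adic valuation. The Toeplitz subshift is torsion free if $\mathbf{v}_p((p_n))\in\{0,\infty\}$ for every prime $p$ (equivalently its maximal equicontinuous factor, the odometer $\mathbb{Z}_{(p_n)}$, is torsion free). For a homeomorphism $S$ of a compact metric space $Y$, $\operatorname{Aut}(Y,S)$ is the group of homeomorphisms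 commuting with $S$ and $\operatorname{Aut}^{(\infty)}(Y,S)=\bigcup_{n\ge1}\operatorname{Aut}(Y,S^n)$. *)

theory Defs
  imports "HOL-Analysis.Analysis" "HOL-Algebra.Group" "HOL-Computational_Algebra.Primes"
    "HOL-Library.Extended_Nat"
begin

text \<open>Two-sided sequences over a finite alphabet (the type 'a, assumed finite
in the theorem) are functions int => 'a. The left shift is (shift x)_k = x_(k+1).\<close>

definition shift :: "(int \<Rightarrow> 'a) \<Rightarrow> (int \<Rightarrow> 'a)" where
  "shift x = (\<lambda>k. x (k + 1))"

definition seqtop :: "(int \<Rightarrow> 'a) topology" where
  "seqtop = product_topology (\<lambda>_. discrete_topology UNIV) UNIV"

definition per :: "nat \<Rightarrow> (int \<Rightarrow> 'a) \<Rightarrow> int set" where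
  "per p u = {k. \<forall>m::int. u k = u (k + int p * m)}"

definition toeplitz :: "(int \<Rightarrow> 'a) \<Rightarrow> bool" where
  "toeplitz u \<longleftrightarrow> (\<forall>n::int. \<exists>m::nat. m \<ge> 1 \<and> (\<forall>k::int. u n = u (n + k * int m)))"

definition periodic_seq :: "(int \<Rightarrow> 'a) \<Rightarrow> bool" where
  "periodic_seq u \<longleftrightarrow> (\<exists>p::nat. p \<ge> 1 \<and> (\<forall>k. u (k + int p) = u k))"

definition essential :: "nat \<Rightarrow> (int \<Rightarrow> 'a) \<Rightarrow> bool" where
  "essential p u \<longleftrightarrow> (\<forall>q. 1 \<le> q \<and> q < p \<longrightarrow> per q u \<noteq> per p u)"

definition period_structure :: "(int \<Rightarrow> 'a) \<Rightarrow> (nat \<Rightarrow> nat) \<Rightarrow> bool" where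
  "period_structure u ps \<longleftrightarrow>
     (\<forall>n. ps n \<ge> 1 \<and> ps n dvd ps (Suc n)) \<and>
     (\<Union>n. per (ps n) u) = UNIV \<and>
     (\<forall>n. essential (ps n) u)"

text \<open>v_p((p_n)) = lim_n nu_p(p_n) in N \<union> {\<infinity>}; the sequence is nondecreasing,
so the limit is the supremum.\<close>
definition vp :: "nat \<Rightarrow> (nat \<Rightarrow> nat) \<Rightarrow> enat" where
  "vp p ps = (SUP n. enat (multiplicity p (ps n)))"

definition torsion_free_scale :: "(nat \<Rightarrow> nat) \<Rightarrow> bool" where
  "torsion_free_scale ps \<longleftrightarrow> (\<forall>p::nat. prime p \<longrightarrow> vp p ps = 0 \<or> vp p ps = \<infinity>)"

definition orbit_closure :: "(int \<Rightarrow> 'a) \<Rightarrow> (int \<Rightarrow> 'a) set" where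
  "orbit_closure u = seqtop closure_of {(\<lambda>k. u (k + j)) | j::int. True}"

text \<open>Aut(Y, S) as a set of homeomorphisms of Y (as a subspace) commuting with S;
to obtain a genuine group under composition, maps are normalised to be the identity
outside Y.\<close>
definition Aut :: "(int \<Rightarrow> 'a) set \<Rightarrow> ((int \<Rightarrow> 'a) \<Rightarrow> (int \<Rightarrow> 'a)) \<Rightarrow> ((int \<Rightarrow> 'a) \<Rightarrow> (int \<Rightarrow> 'a)) set" where
  "Aut Y S = {f. homeomorphic_map (subtopology seqtop Y) (subtopology seqtop Y) f \<and>
                 (\<forall>x\<in>Y. f (S x) = S (f x)) \<and> (\<forall>x. x \<notin> Y \<longrightarrow> f x = x)}"

definition Aut_inf :: "(int \<Rightarrow> 'a) set \<Rightarrow> ((int \<Rightarrow> 'a) \<Rightarrow> (int \<Rightarrow> 'a)) set" where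
  "Aut_inf Y = (\<Union>n\<in>{1..}. Aut Y (shift ^^ n))"

definition Aut_inf_group :: "(int \<Rightarrow> 'a) set \<Rightarrow> ((int \<Rightarrow> 'a) \<Rightarrow> (int \<Rightarrow> 'a)) monoid" where
  "Aut_inf_group Y = \<lparr>carrier = Aut_inf Y, mult = (\<circ>), one = id\<rparr>"

end

theory Submission
  imports Defs
begin

text \<open>
  An automorphism of a Toeplitz subshift is determined by its action on the odometer, and an element
  commuting with a power of the shift acts there, for some \<open>K\<close>, by a translation on each class modulo
  \<open>ps K\<close>. If a prime \<open>p\<close> divides some \<open>ps k\<close>, there is a rotation of order \<open>p\<close> without fixed points.
  If \<open>p\<close> divides no \<open>ps k\<close>, then an element of order \<open>p\<close> permutes a number of classes prime to \<open>p\<close>,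
  hence stabilizes one of them, and there it is a translation of order dividing \<open>p\<close> in an odometer without
  \<open>p\<close>-torsion, i.e. the identity. Elements of order \<open>p\<close> with and without fixed points
  are told apart by the group: in the former case the centralizer contains two elements of infinite
  order, living on the fixed point set and on its complement, such that all conjugates of
  commutators with the one commute with the other. So the group determines the set of primes that
  divide the scale, which for a torsion-free scale is all that \<open>vp\<close> can see.
\<close>

section \<open>Sequence spaces\<close>

definition translate :: "int \<Rightarrow> (int \<Rightarrow> 'a) \<Rightarrow> (int \<Rightarrow> 'a)" where
  "translate j x = (\<lambda>k. x (k + j))"

text \<open>The sets \<open>{y. agree L x y}\<close> form a neighbourhood base at \<open>x\<close>
  in the product topology, so openness, continuity and closure can all be phrased by finite
  windows.\<close>

definition agree :: "nat \<Rightarrow> (int \<Rightarrow> 'a) \<Rightarrow> (int \<Rightarrow> 'a) \<Rightarrow> bool" where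
  "agree L x y \<longleftrightarrow> (\<forall>k. \<bar>k\<bar> \<le> int L \<longrightarrow> x k = y k)"

lemma translate_translate [simp]: "translate i (translate j x) = translate (i + j) x"
  by (simp add: translate_def add.assoc fun_eq_iff)

lemma translate_0 [simp]: "translate 0 x = x"
  by (simp add: translate_def)

lemma translate_eq_iff: "translate i x = y \<longleftrightarrow> x = translate (- i) y"
  by (metis translate_translate translate_0 add.right_inverse add.left_inverse)

lemma shift_funpow: "(shift ^^ n) x = translate (int n) x"
  by (induction n) (simp_all add: shift_def translate_def fun_eq_iff algebra_simps)

lemma agree_refl [simp]: "agree L x x"
  by (simp add: agree_def)

lemma agree_sym: "agree L x y \<Longrightarrow> agree L y x"
  by (simp add: agree_def)

lemma agree_trans: "agree L x y \<Longrightarrow> agree L y z \<Longrightarrow> agree L x z"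
  by (simp add: agree_def)

lemma agree_mono: "agree L x y \<Longrightarrow> M \<le> L \<Longrightarrow> agree M x y"
  by (simp add: agree_def)

lemma agree_translate:
  "agree (L + nat \<bar>i\<bar>) x y \<Longrightarrow> agree L (translate i x) (translate i y)"
  unfolding agree_def translate_def by auto

lemma agree_all_imp_eq: "(\<And>L. agree L x y) \<Longrightarrow> x = y"
  unfolding agree_def fun_eq_iff using nat_le_iff by blast

lemma topspace_seqtop [simp]: "topspace seqtop = UNIV"
  by (simp add: seqtop_def)

text \<open>A basic open set restricts finitely many coordinates, and these fit into one window.
  Conversely, agreement on a window is a basic open condition, because each coordinate is
  discrete.\<close>

lemma openin_seqtop_iff:
  "openin seqtop U \<longleftrightarrow> (\<forall>x\<in>U. \<exists>L. \<forall>y. agree L x y \<longrightarrow> y \<in> U)" (is "?l \<longleftrightarrow> ?r")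
proof
  assume l: ?l
  show ?r
  proof
    fix x assume "x \<in> U"
    then obtain V where V: "finite {i. V i \<noteq> (UNIV :: 'a set)}" "x \<in> Pi\<^sub>E UNIV V" "Pi\<^sub>E UNIV V \<subseteq> U"
      using l unfolding seqtop_def openin_product_topology_alt by auto
    obtain B :: int where B: "\<forall>i\<in>{i. V i \<noteq> UNIV}. \<bar>i\<bar> \<le> B"
      using finite_imageI[OF V(1), of abs] by (metis bdd_above.E bdd_above_finite imageI)
    have "y \<in> U" if "agree (nat B) x y" for y
    proof -
      have "y i \<in> V i" for i
      proof (cases "V i = UNIV")
        case False
        with B have "\<bar>i\<bar> \<le> B" by blast
        then have "\<bar>i\<bar> \<le> int (nat B)" by linarith
        then have "x i = y i" using that unfolding agree_def by blast
        then show ?thesis using V(2) by (metis PiE_mem UNIV_I)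
      qed simp
      then show ?thesis using V(3) by auto
    qed
    then show "\<exists>L. \<forall>y. agree L x y \<longrightarrow> y \<in> U" by blast
  qed
next
  assume r: ?r
  show ?l
    unfolding seqtop_def openin_product_topology_alt
  proof (intro ballI)
    fix x assume "x \<in> U"
    then obtain L where L: "\<forall>y. agree L x y \<longrightarrow> y \<in> U" using r by blast
    define V where "V i = (if \<bar>i\<bar> \<le> int L then {x i} else UNIV)" for i
    have "finite {i. V i \<noteq> UNIV}"
      by (rule finite_subset[of _ "{- int L..int L}"]) (auto simp: V_def)
    moreover have "x \<in> Pi\<^sub>E UNIV V" by (auto simp: V_def)
    moreover have "Pi\<^sub>E UNIV V \<subseteq> U"
      using L by (fastforce simp: V_def agree_def PiE_iff split: if_splits)
    ultimately show "\<exists>V. finite {i \<in> UNIV. V i \<noteq> topspace (discrete_topology UNIV)} \<and>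
        (\<forall>i\<in>UNIV. openin (discrete_topology UNIV) (V i)) \<and> x \<in> Pi\<^sub>E UNIV V \<and> Pi\<^sub>E UNIV V \<subseteq> U"
      by (intro exI[of _ V]) auto
  qed
qed

lemma openin_agree: "openin seqtop {y. agree L x y}"
  unfolding openin_seqtop_iff by (blast intro: agree_trans)

lemma continuous_map_seqtop_iff:
  "continuous_map (subtopology seqtop X) (subtopology seqtop Y) f \<longleftrightarrow>
     f \<in> X \<rightarrow> Y \<and> (\<forall>x\<in>X. \<forall>L. \<exists>M. \<forall>y\<in>X. agree M x y \<longrightarrow> agree L (f x) (f y))" (is "?l \<longleftrightarrow> ?r")
proof
  assume l: ?l
  then have "continuous_map (subtopology seqtop X) seqtop f" and sub: "f \<in> X \<rightarrow> Y"
    by (auto simp: continuous_map_in_subtopology)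
  then have pre: "openin (subtopology seqtop X) {z \<in> X. agree L (f x) (f z)}" for x L
    using openin_continuous_map_preimage[OF _ openin_agree[of L "f x"]] by fastforce
  have "\<exists>M. \<forall>y\<in>X. agree M x y \<longrightarrow> agree L (f x) (f y)" if x: "x \<in> X" for x L
  proof -
    obtain V where V: "openin seqtop V" "{z \<in> X. agree L (f x) (f z)} = V \<inter> X"
      using pre[of L x] unfolding openin_subtopology by blast
    have "x \<in> {z \<in> X. agree L (f x) (f z)}" using x by simp
    then have "x \<in> V" unfolding V(2) by blast
    then obtain M where M: "\<forall>y. agree M x y \<longrightarrow> y \<in> V"
      using V(1) unfolding openin_seqtop_iff by blast
    have "agree L (f x) (f y)" if "y \<in> X" "agree M x y" for y
      using that M equalityD2[OF V(2)] by blast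
    then show ?thesis by blast
  qed
  then show ?r using sub by blast
next
  assume r: ?r
  have "openin (subtopology seqtop X) {z \<in> X. f z \<in> U}" if U: "openin seqtop U" for U
  proof -
    \<comment> \<open>The preimage is only open relative to \<open>X\<close>. \<open>V\<close> is
      the union of windows around its points, each so small that \<open>f\<close> maps its part
      inside \<open>X\<close> into \<open>U\<close>.\<close>
    define V where "V = {y. \<exists>x\<in>X. f x \<in> U \<and> (\<exists>M. agree M x y \<and> (\<forall>z\<in>X. agree M x z \<longrightarrow> f z \<in> U))}"
    have "openin seqtop V"
      unfolding openin_seqtop_iff V_def by (blast intro: agree_trans)
    moreover have "{z \<in> X. f z \<in> U} = V \<inter> X"
    proof (intro equalityI subsetI)
      fix z assume "z \<in> {z \<in> X. f z \<in> U}"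
      then have z: "z \<in> X" "f z \<in> U" by auto
      then obtain L where "\<forall>y. agree L (f z) y \<longrightarrow> y \<in> U"
        using U unfolding openin_seqtop_iff by blast
      then obtain M where "\<forall>y\<in>X. agree M z y \<longrightarrow> f y \<in> U"
        using r z(1) by meson
      then show "z \<in> V \<inter> X" unfolding V_def using z agree_refl by blast
    qed (auto simp: V_def)
    ultimately show ?thesis unfolding openin_subtopology by blast
  qed
  then have "continuous_map (subtopology seqtop X) seqtop f"
    by (simp add: continuous_map_def)
  then show ?l using r by (simp add: continuous_map_in_subtopology)
qed

lemma mem_orbit_closure_iff:
  "x \<in> orbit_closure u \<longleftrightarrow> (\<forall>L. \<exists>j. agree L x (translate j u))" (is "?l \<longleftrightarrow> ?r")
proof
  assume ?l
  then have *: "\<exists>y. (\<exists>j. y = translate j u) \<and> y \<in> U" if "x \<in> U" "openin seqtop U" for U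
    using that unfolding orbit_closure_def in_closure_of translate_def by blast
  show ?r
  proof
    fix L
    show "\<exists>j. agree L x (translate j u)"
      using *[of "{y. agree L x y}", OF _ openin_agree] by auto
  qed
next
  assume r: ?r
  have "\<exists>y. (\<exists>j. y = translate j u) \<and> y \<in> U" if U: "x \<in> U" "openin seqtop U" for U
  proof -
    obtain L where "\<forall>y. agree L x y \<longrightarrow> y \<in> U"
      using U unfolding openin_seqtop_iff by blast
    then show ?thesis using r by blast
  qed
  then show ?l
    unfolding orbit_closure_def in_closure_of translate_def by auto
qed

section \<open>The stabilized automorphism group\<close>

definition pointwise_cont :: "(int \<Rightarrow> 'a) set \<Rightarrow> ((int \<Rightarrow> 'a) \<Rightarrow> (int \<Rightarrow> 'a)) \<Rightarrow> bool" where
  "pointwise_cont X f \<longleftrightarrow> (\<forall>x\<in>X. \<forall>L. \<exists>M. \<forall>y\<in>X. agree M x y \<longrightarrow> agree L (f x) (f y))"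

text \<open>Nothing is prescribed outside \<open>X\<close>, so that the inverse delivered by a
  homeomorphism can be used as it comes.\<close>

definition inverse_pair :: "(int \<Rightarrow> 'a) set \<Rightarrow> ((int \<Rightarrow> 'a) \<Rightarrow> (int \<Rightarrow> 'a)) \<Rightarrow> ((int \<Rightarrow> 'a) \<Rightarrow> (int \<Rightarrow> 'a)) \<Rightarrow> bool" where
  "inverse_pair X f f' \<longleftrightarrow> f \<in> X \<rightarrow> X \<and> f' \<in> X \<rightarrow> X \<and> (\<forall>x\<in>X. f' (f x) = x) \<and> (\<forall>x\<in>X. f (f' x) = x) \<and>
     pointwise_cont X f \<and> pointwise_cont X f'"

lemma Aut_iff:
  "f \<in> Aut X S \<longleftrightarrow> (\<exists>f'. inverse_pair X f f') \<and> (\<forall>x\<in>X. f (S x) = S (f x)) \<and> (\<forall>x. x \<notin> X \<longrightarrow> f x = x)"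
proof -
  have "homeomorphic_maps (subtopology seqtop X) (subtopology seqtop X) f f' \<longleftrightarrow> inverse_pair X f f'" for f'
    unfolding homeomorphic_maps_def continuous_map_seqtop_iff inverse_pair_def pointwise_cont_def
    by auto
  then show ?thesis
    unfolding Aut_def homeomorphic_map_maps by blast
qed

lemma inverse_pair_mem:
  "inverse_pair X f f' \<Longrightarrow> x \<in> X \<Longrightarrow> f x \<in> X"
  "inverse_pair X f f' \<Longrightarrow> x \<in> X \<Longrightarrow> f' x \<in> X"
  by (auto simp: inverse_pair_def)

lemma inverse_pair_sym: "inverse_pair X f f' \<Longrightarrow> inverse_pair X f' f"
  by (auto simp: inverse_pair_def)

lemma pointwise_cont_compose:
  assumes "pointwise_cont X f" "pointwise_cont X g" "g \<in> X \<rightarrow> X"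
  shows "pointwise_cont X (f \<circ> g)"
  unfolding pointwise_cont_def
proof (intro ballI allI)
  fix x L assume x: "x \<in> X"
  with assms(3) have "g x \<in> X" by blast
  with assms(1) obtain M where "\<forall>y\<in>X. agree M (g x) y \<longrightarrow> agree L (f (g x)) (f y)"
    unfolding pointwise_cont_def by blast
  moreover obtain M' where "\<forall>y\<in>X. agree M' x y \<longrightarrow> agree M (g x) (g y)"
    using assms(2) x unfolding pointwise_cont_def by blast
  ultimately show "\<exists>M. \<forall>y\<in>X. agree M x y \<longrightarrow> agree L ((f \<circ> g) x) ((f \<circ> g) y)"
    using assms(3) by (metis comp_apply funcset_mem)
qed

lemma inverse_pair_compose:
  assumes "inverse_pair X f f'" "inverse_pair X g g'"
  shows "inverse_pair X (f \<circ> g) (g' \<circ> f')"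
  using assms unfolding inverse_pair_def by (simp add: pointwise_cont_compose Pi_iff)

lemma translate_mem_orbit_closure:
  assumes "x \<in> orbit_closure u"
  shows "translate i x \<in> orbit_closure u"
  unfolding mem_orbit_closure_iff
proof
  fix L
  obtain j where "agree (L + nat \<bar>i\<bar>) x (translate j u)"
    using assms unfolding mem_orbit_closure_iff by blast
  from agree_translate[OF this]
  show "\<exists>j. agree L (translate i x) (translate j u)" by auto
qed

lemma translate_mem_orbit_closure_iff [simp]:
  "translate i x \<in> orbit_closure u \<longleftrightarrow> x \<in> orbit_closure u"
  using translate_mem_orbit_closure[of "translate i x" u "- i"] translate_mem_orbit_closure[of x u i]
  by auto

lemma orbit_subset_closure [simp]: "u \<in> orbit_closure u"
  unfolding mem_orbit_closure_iff by (metis agree_refl translate_0)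

lemma Aut_translate:
  assumes "f \<in> Aut (orbit_closure u) (shift ^^ n)" "x \<in> orbit_closure u" "int n dvd j"
  shows "f (translate j x) = translate j (f x)"
proof -
  have step: "f (translate (int n) x) = translate (int n) (f x)" if "x \<in> orbit_closure u" for x
    using assms(1) that unfolding Aut_def shift_funpow by blast
  have up: "f (translate (int k * int n) x) = translate (int k * int n) (f x)" if "x \<in> orbit_closure u" for x k
    using that
  proof (induction k)
    case (Suc k)
    have split: "translate (int (Suc k) * int n) z = translate (int n) (translate (int k * int n) z)" for z
      by (simp add: algebra_simps)
    have "translate (int k * int n) x \<in> orbit_closure u" using Suc.prems by simp
    then show ?case
      unfolding split using step Suc by (simp del: translate_translate)
  qed simp
  obtain m where m: "j = m * int n" using assms(3) by (metis dvdE mult.commute)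
  show ?thesis
  proof (cases "m \<ge> 0")
    case True
    then show ?thesis using up[OF assms(2), of "nat m"] m by simp
  next
    case False
    then have j: "j = - (int (nat (- m)) * int n)" using m by simp
    \<comment> \<open>A negative translation is handled by applying the positive case to the point
      \<open>translate j x\<close>.\<close>
    have "f x = f (translate (int (nat (- m)) * int n) (translate j x))"
      using j by simp
    also have "\<dots> = translate (- j) (f (translate j x))"
      using up[of "translate j x" "nat (- m)"] assms(2) j by simp
    finally show ?thesis by simp
  qed
qed

text \<open>Makes the union \<open>Aut_inf\<close> directed: two elements lie in a common
  \<open>Aut\<close>, namely the one for the product of their exponents.\<close>

lemma Aut_mono:
  assumes "f \<in> Aut (orbit_closure u) (shift ^^ n)" "n dvd m"
  shows "f \<in> Aut (orbit_closure u) (shift ^^ m)"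
  using assms(1) Aut_translate[OF assms(1), of _ "int m"] assms(2)
  unfolding Aut_def shift_funpow by simp

lemma Aut_infE:
  assumes "f \<in> Aut_inf (orbit_closure u)"
  obtains n where "n \<ge> 1" "f \<in> Aut (orbit_closure u) (shift ^^ n)"
  using assms unfolding Aut_inf_def by auto

lemma Aut_infI: "n \<ge> 1 \<Longrightarrow> f \<in> Aut X (shift ^^ n) \<Longrightarrow> f \<in> Aut_inf X"
  unfolding Aut_inf_def by auto

lemma Aut_inf_compose:
  assumes f: "f \<in> Aut_inf (orbit_closure u)" and g: "g \<in> Aut_inf (orbit_closure u)"
  shows "f \<circ> g \<in> Aut_inf (orbit_closure u)"
proof -
  let ?X = "orbit_closure u"
  obtain m n where m: "m \<ge> 1" "f \<in> Aut ?X (shift ^^ m)" and n: "n \<ge> 1" "g \<in> Aut ?X (shift ^^ n)"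
    using f g by (metis Aut_infE)
  have f: "f \<in> Aut ?X (shift ^^ (m * n))" and g: "g \<in> Aut ?X (shift ^^ (m * n))"
    using m n by (auto intro: Aut_mono)
  have "\<exists>f'. inverse_pair ?X (f \<circ> g) f'"
    using f g inverse_pair_compose unfolding Aut_iff by blast
  moreover have "f (g (translate (int (m * n)) x)) = translate (int (m * n)) (f (g x))" if x: "x \<in> ?X" for x
  proof -
    have "g x \<in> ?X" using g x inverse_pair_mem unfolding Aut_iff by blast
    then show ?thesis
      using Aut_translate[OF g x dvd_refl] Aut_translate[OF f _ dvd_refl] by simp
  qed
  ultimately have "f \<circ> g \<in> Aut ?X (shift ^^ (m * n))"
    using f g unfolding Aut_iff shift_funpow by simp
  then show ?thesis using m n by (intro Aut_infI[of "m * n"]) auto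
qed

lemma Aut_inf_id: "id \<in> Aut_inf (orbit_closure u)"
proof (rule Aut_infI[OF order_refl])
  have "inverse_pair (orbit_closure u) id id"
    by (auto simp: inverse_pair_def pointwise_cont_def)
  then show "id \<in> Aut (orbit_closure u) (shift ^^ 1)"
    unfolding Aut_iff by auto
qed

lemma Aut_inf_inverse:
  assumes f: "f \<in> Aut_inf (orbit_closure u)"
  shows "\<exists>f'\<in>Aut_inf (orbit_closure u). f' \<circ> f = id"
proof -
  let ?X = "orbit_closure u"
  obtain n where n: "n \<ge> 1" "f \<in> Aut ?X (shift ^^ n)" using f by (rule Aut_infE)
  then obtain f' where f': "inverse_pair ?X f f'" unfolding Aut_iff by blast
  \<comment> \<open>The inverse \<open>f'\<close> is arbitrary outside \<open>X\<close>;
    \<open>h\<close> is normalised there as \<open>Aut\<close> demands.\<close>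
  define h where "h x = (if x \<in> ?X then f' x else x)" for x
  have "inverse_pair ?X h f"
    using inverse_pair_sym[OF f'] unfolding inverse_pair_def pointwise_cont_def h_def
    by (simp add: Pi_iff)
  moreover have "h (translate (int n) x) = translate (int n) (h x)" if x: "x \<in> ?X" for x
  proof -
    have fx: "f' x \<in> ?X" using inverse_pair_mem(2)[OF f' x] .
    have "f (translate (int n) (f' x)) = translate (int n) x"
      using Aut_translate[OF n(2) fx dvd_refl] f' x by (simp add: inverse_pair_def)
    moreover have "f' (f (translate (int n) (f' x))) = translate (int n) (f' x)"
      using f' fx by (simp add: inverse_pair_def)
    ultimately show ?thesis using x by (simp add: h_def)
  qed
  ultimately have "h \<in> Aut ?X (shift ^^ n)"
    unfolding Aut_iff shift_funpow by (auto simp: h_def)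
  moreover have "h (f x) = x" for x
  proof (cases "x \<in> ?X")
    case True
    then show ?thesis using f' inverse_pair_mem(1)[OF f'] by (simp add: h_def inverse_pair_def)
  next
    case False
    then show ?thesis using n(2) by (simp add: h_def Aut_iff)
  qed
  ultimately show ?thesis using Aut_infI[OF n(1)] by (intro bexI[of _ h]) (auto simp: fun_eq_iff)
qed

lemma group_Aut_inf_group: "group (Aut_inf_group (orbit_closure u))"
  by (rule groupI)
    (auto simp: Aut_inf_group_def Aut_inf_id intro: Aut_inf_inverse Aut_inf_compose comp_assoc)

lemma Aut_inf_pow: "f [^]\<^bsub>Aut_inf_group X\<^esub> (n::nat) = f ^^ n"
  by (induction n) (simp_all add: Aut_inf_group_def nat_pow_def funpow_Suc_right del: funpow.simps(2))

section \<open>A group-theoretic invariant\<close>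

definition centr :: "('g, 'm) monoid_scheme \<Rightarrow> 'g \<Rightarrow> 'g set" where
  "centr G g = {x \<in> carrier G. x \<otimes>\<^bsub>G\<^esub> g = g \<otimes>\<^bsub>G\<^esub> x}"

text \<open>The equations for \<open>c\<close> and \<open>d\<close> say, without inverses, that \<open>c = x\<^sup>-\<^sup>1 h\<^sup>-\<^sup>1 x h\<close> and
  \<open>d = t c t\<^sup>-\<^sup>1\<close>. In \<open>Aut_inf_group\<close>, the condition \<open>x ^ p \<noteq> 1\<close> excludes elements that act
  locally as powers of \<open>g\<close>.\<close>

definition has_free_torsion :: "nat \<Rightarrow> ('g, 'm) monoid_scheme \<Rightarrow> bool" where
  "has_free_torsion p G \<longleftrightarrow> (\<exists>g\<in>carrier G. g \<noteq> \<one>\<^bsub>G\<^esub> \<and> g [^]\<^bsub>G\<^esub> p = \<one>\<^bsub>G\<^esub> \<and>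
     (\<forall>x\<in>centr G g. \<forall>y\<in>centr G g. x [^]\<^bsub>G\<^esub> p \<noteq> \<one>\<^bsub>G\<^esub> \<and> y [^]\<^bsub>G\<^esub> p \<noteq> \<one>\<^bsub>G\<^esub> \<longrightarrow>
       (\<exists>h\<in>centr G g. \<exists>t\<in>centr G g. \<exists>c\<in>carrier G. \<exists>d\<in>carrier G.
          h \<otimes>\<^bsub>G\<^esub> x \<otimes>\<^bsub>G\<^esub> c = x \<otimes>\<^bsub>G\<^esub> h \<and> d \<otimes>\<^bsub>G\<^esub> t = t \<otimes>\<^bsub>G\<^esub> c \<and> d \<otimes>\<^bsub>G\<^esub> y \<noteq> y \<otimes>\<^bsub>G\<^esub> d)))"

text \<open>The property is expressed by the group operation alone, and an isomorphism carries the
  centralizer of \<open>g\<close> onto that of \<open>\<phi> g\<close>.\<close>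

lemma has_free_torsion_iso:
  fixes G (structure)
  assumes G: "group G" and H: "group H" and \<phi>: "\<phi> \<in> iso G H" and "has_free_torsion p G"
  shows "has_free_torsion p H"
proof -
  interpret group_hom G H \<phi>
    using G H \<phi> by (simp add: group_hom_def group_hom_axioms_def iso_def)
  have bij: "bij_betw \<phi> (carrier G) (carrier H)" using \<phi> by (simp add: iso_def)
  then have inj: "\<phi> x = \<phi> y \<longleftrightarrow> x = y" if "x \<in> carrier G" "y \<in> carrier G" for x y
    using that by (metis bij_betw_def inj_on_eq_iff)
  have one: "\<phi> x = \<one>\<^bsub>H\<^esub> \<longleftrightarrow> x = \<one>" if "x \<in> carrier G" for x
    using inj[OF that G.one_closed] by simp
  have pow: "\<phi> x [^]\<^bsub>H\<^esub> n = \<one>\<^bsub>H\<^esub> \<longleftrightarrow> x [^] n = \<one>" if "x \<in> carrier G" for x and n :: nat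
    using that one[of "x [^] n"] by (simp add: hom_nat_pow)
  have centr: "centr H (\<phi> g) = \<phi> ` centr G g" if g: "g \<in> carrier G" for g
  proof -
    have "\<phi> x \<in> centr H (\<phi> g) \<longleftrightarrow> x \<in> centr G g" if "x \<in> carrier G" for x
      using g that inj[of "x \<otimes> g" "g \<otimes> x"] by (simp add: centr_def)
    moreover have "centr H (\<phi> g) \<subseteq> \<phi> ` carrier G" "centr G g \<subseteq> carrier G"
      using bij by (auto simp: centr_def bij_betw_def)
    ultimately show ?thesis by blast
  qed
  obtain g where g: "g \<in> carrier G" "g \<noteq> \<one>" "g [^] p = \<one>"
    and *: "\<And>x y. x \<in> centr G g \<Longrightarrow> y \<in> centr G g \<Longrightarrow> x [^] p \<noteq> \<one> \<Longrightarrow> y [^] p \<noteq> \<one> \<Longrightarrow>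
       \<exists>h\<in>centr G g. \<exists>t\<in>centr G g. \<exists>c\<in>carrier G. \<exists>d\<in>carrier G.
          h \<otimes> x \<otimes> c = x \<otimes> h \<and> d \<otimes> t = t \<otimes> c \<and> d \<otimes> y \<noteq> y \<otimes> d"
    using assms(4) unfolding has_free_torsion_def by blast
  show ?thesis
    unfolding has_free_torsion_def
  proof (rule bexI[of _ "\<phi> g"], intro conjI ballI impI, goal_cases)
    case (3 x' y')
    then obtain x y where xy: "x \<in> centr G g" "y \<in> centr G g" "x' = \<phi> x" "y' = \<phi> y"
      using centr[OF g(1)] by blast
    have C: "centr G g \<subseteq> carrier G" by (auto simp: centr_def)
    have xy': "x \<in> carrier G" "y \<in> carrier G" using xy(1,2) C by auto
    have "x [^] p \<noteq> \<one>" "y [^] p \<noteq> \<one>" using 3(3) xy(3,4) pow xy' by auto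
    from *[OF xy(1,2) this]
    obtain h t c d where htcd: "h \<in> centr G g" "t \<in> centr G g" "c \<in> carrier G" "d \<in> carrier G"
      "h \<otimes> x \<otimes> c = x \<otimes> h" "d \<otimes> t = t \<otimes> c" "d \<otimes> y \<noteq> y \<otimes> d"
      by (elim bexE conjE) (rule that; assumption)
    have mem: "x \<in> carrier G" "y \<in> carrier G" "h \<in> carrier G" "t \<in> carrier G"
      using xy' htcd(1,2) C by auto
    have "\<phi> h \<otimes>\<^bsub>H\<^esub> x' \<otimes>\<^bsub>H\<^esub> \<phi> c = x' \<otimes>\<^bsub>H\<^esub> \<phi> h"
      using arg_cong[OF htcd(5), of \<phi>] mem htcd(3) xy by simp
    moreover have "\<phi> d \<otimes>\<^bsub>H\<^esub> \<phi> t = \<phi> t \<otimes>\<^bsub>H\<^esub> \<phi> c"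
      using arg_cong[OF htcd(6), of \<phi>] mem htcd(3,4) by simp
    moreover have "\<phi> d \<otimes>\<^bsub>H\<^esub> y' \<noteq> y' \<otimes>\<^bsub>H\<^esub> \<phi> d"
      using htcd(7) inj[of "d \<otimes> y" "y \<otimes> d"] mem htcd(4) xy by simp
    moreover have "\<phi> h \<in> centr H (\<phi> g)" "\<phi> t \<in> centr H (\<phi> g)"
      using centr[OF g(1)] htcd by auto
    ultimately show ?case
      using hom_closed[OF htcd(3)] hom_closed[OF htcd(4)] by blast
  qed (use g one pow in auto)
qed

section \<open>Permutations of prime order\<close>

text \<open>Without a fixed point every orbit would have exactly \<open>p\<close> elements, and the
  orbits would partition \<open>S\<close> into sets of size \<open>p\<close>.\<close>

lemma prime_order_fixed_point:
  fixes f :: "'c \<Rightarrow> 'c"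
  assumes p: "prime p" and S: "finite S" "f ` S \<subseteq> S" and f: "\<And>x. x \<in> S \<Longrightarrow> (f ^^ p) x = x"
    and card: "\<not> p dvd card S"
  shows "\<exists>x\<in>S. f x = x"
proof (rule ccontr)
  assume "\<not> ?thesis"
  then have nofix: "\<And>x. x \<in> S \<Longrightarrow> f x \<noteq> x" by blast
  have p0: "p > 0" using p prime_gt_0_nat by blast
  have memS: "(f ^^ i) x \<in> S" if "x \<in> S" for i x
    using that S(2) by (induction i) auto
  have mult: "(f ^^ (p * k)) x = x" if "x \<in> S" for x k
    using that by (induction k) (simp_all add: funpow_add f)
  have modp: "(f ^^ i) x = (f ^^ (i mod p)) x" if "x \<in> S" for i x
    using mult[OF that, of "i div p"] funpow_add[of "i mod p" "p * (i div p)" f]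
    by (simp add: add.commute)
  define orb where "orb x = (\<lambda>i. (f ^^ i) x) ` {..<p}" for x
  have self: "x \<in> orb x" for x using p0 unfolding orb_def by (force intro: image_eqI[of _ _ 0])
  have iter: "(f ^^ i) x \<in> orb x" if "x \<in> S" for i x
    using modp[OF that, of i] p0 unfolding orb_def by auto
  have orb_eq: "orb ((f ^^ i) x) = orb x" if "x \<in> S" for i x
  proof -
    have 1: "orb ((f ^^ i) x) \<subseteq> orb x" if "x \<in> S" for i x
      using iter[OF that] unfolding orb_def[of "(f ^^ i) x"] by (auto simp flip: funpow_add[THEN fun_cong, unfolded comp_apply])
    \<comment> \<open>Since \<open>f ^^ (p * i)\<close> is the identity on \<open>S\<close>, the
      iterate with exponent \<open>k = p * i - i\<close> undoes \<open>f ^^ i\<close>.\<close>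
    obtain k where k: "p * i = i + k" using p0 by (metis le_add_diff_inverse mult_le_mono1 mult_1 Suc_leI One_nat_def)
    have "x = (f ^^ k) ((f ^^ i) x)"
      using mult[OF that, of i] k by (metis add.commute comp_apply funpow_add)
    then show ?thesis using 1[OF that, of i] 1[OF memS[OF that], of k i] by auto
  qed
  have inj: "inj_on (\<lambda>i. (f ^^ i) x) {..<p}" if x: "x \<in> S" for x
  proof (rule linorder_inj_onI')
    fix i j assume ij: "i \<in> {..<p}" "j \<in> {..<p}" "i < j"
    show "(f ^^ i) x \<noteq> (f ^^ j) x"
    proof
      assume eq: "(f ^^ i) x = (f ^^ j) x"
      define y where "y = (f ^^ i) x"
      define m where "m = j - i"
      have y: "y \<in> S" unfolding y_def by (rule memS[OF x])
      have m: "0 < m" "m < p" using ij by (auto simp: m_def)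
      have fm: "(f ^^ m) y = y"
        using eq ij funpow_add[of m i f] by (simp add: y_def m_def)
      have fmk: "(f ^^ (m * k)) y = y" for k
        using fm by (induction k) (simp_all add: funpow_add)
      \<comment> \<open>By Bezout some multiple of \<open>m\<close> is \<open>1\<close> modulo
        \<open>p\<close>, so a point fixed by both \<open>f ^^ m\<close> and \<open>f ^^ p\<close>
        is fixed by \<open>f\<close>.\<close>
      have "coprime m p"
        using m p by (metis coprime_commute dvd_imp_le linorder_not_less prime_imp_coprime)
      then obtain a b where "m * a = p * b + 1"
        using bezout_nat[of m p] m by auto
      then have "f y = y"
        using fmk[of a] mult[OF y, of b] by simp
      then show False using nofix[OF y] by simp
    qed
  qed
  have "p * card (orb ` S) = card (\<Union> (orb ` S))"
  proof (rule card_partition)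
    show "finite (orb ` S)" "finite (\<Union> (orb ` S))"
      using S(1) unfolding orb_def by auto
    show "card c = p" if "c \<in> orb ` S" for c
      using that inj unfolding orb_def by (auto simp: card_image)
    show "c1 \<inter> c2 = {}" if c: "c1 \<in> orb ` S" "c2 \<in> orb ` S" "c1 \<noteq> c2" for c1 c2
    proof (rule ccontr)
      assume "c1 \<inter> c2 \<noteq> {}"
      then obtain z where z: "z \<in> c1" "z \<in> c2" by blast
      obtain x y where xy: "x \<in> S" "y \<in> S" "c1 = orb x" "c2 = orb y" using c by blast
      then obtain i j where "z = (f ^^ i) x" "z = (f ^^ j) y"
        using z unfolding orb_def by blast
      then show False using orb_eq[OF xy(1), of i] orb_eq[OF xy(2), of j] xy c(3) by metis
    qed
  qed
  moreover have "\<Union> (orb ` S) = S"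
    using self memS unfolding orb_def by auto
  ultimately show False using card by (metis dvd_triv_left)
qed

section \<open>The odometer factor\<close>

locale aperiodic_toeplitz =
  fixes u :: "int \<Rightarrow> 'a" and ps :: "nat \<Rightarrow> nat"
  assumes aperiodic: "\<not> periodic_seq u" and scale: "period_structure u ps"
begin

abbreviation X :: "(int \<Rightarrow> 'a) set" where "X \<equiv> orbit_closure u"
abbreviation orb :: "int \<Rightarrow> int \<Rightarrow> 'a" where "orb j \<equiv> translate j u"

lemma ps_pos: "ps k > 0"
  using scale unfolding period_structure_def by (simp add: Suc_le_eq)

lemma ps_dvd: "k \<le> m \<Longrightarrow> ps k dvd ps m"
proof (induction rule: dec_induct)
  case (step n)
  then show ?case using scale dvd_trans unfolding period_structure_def by blast
qed simp

section \<open>Periodic positions along the scale\<close>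

lemma per_mono: "p dvd q \<Longrightarrow> per p u \<subseteq> per q u"
  unfolding per_def by (auto elim!: dvdE) (metis mult.assoc)

lemma covered: "\<exists>m\<ge>k. i \<in> per (ps m) u"
proof -
  obtain n where "i \<in> per (ps n) u"
    using scale unfolding period_structure_def by blast
  then have "i \<in> per (ps (max k n)) u"
    using per_mono[OF ps_dvd[of n "max k n"]] by auto
  then show ?thesis by (meson max.cobounded1)
qed

text \<open>The scale is a divisibility chain, so the finitely many positions of a window share one
  period. This is the regular recurrence of \<open>u\<close>.\<close>

lemma covered_window: "\<exists>m\<ge>k. \<forall>i. \<bar>i - j\<bar> \<le> int L \<longrightarrow> i \<in> per (ps m) u"
proof -
  obtain M where M: "\<And>i. i \<in> per (ps (M i)) u" using covered by metis
  define m where "m = Max (insert k (M ` {j - int L..j + int L}))"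
  have "i \<in> per (ps m) u" if "\<bar>i - j\<bar> \<le> int L" for i
  proof -
    have "i \<in> {j - int L..j + int L}" using that by (auto simp: abs_le_iff)
    then have "M i \<le> m" unfolding m_def by (intro Max_ge) auto
    then show ?thesis using M per_mono[OF ps_dvd] by blast
  qed
  moreover have "k \<le> m" unfolding m_def by (intro Max_ge) auto
  ultimately show ?thesis by blast
qed

lemma per_dest: "i \<in> per p u \<Longrightarrow> int p dvd i - j \<Longrightarrow> u i = u j"
  unfolding per_def by (smt (verit, ccfv_threshold) dvd_def dvd_minus_iff mem_Collect_eq)

lemma approx:
  assumes "x \<in> X"
  obtains j where "agree L x (orb j)"
  using assms unfolding mem_orbit_closure_iff by blast

lemma orb_mem [simp]: "orb j \<in> X"
  by simp

lemma orb_aperiodic: "translate j (orb i) = orb i \<Longrightarrow> j = 0"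
proof (rule ccontr)
  assume eq: "translate j (orb i) = orb i" and "j \<noteq> 0"
  have "u (k + j) = u k" for k
    using fun_cong[OF eq, of "k - i"] by (simp add: translate_def algebra_simps)
  moreover from this have "u (k - j) = u k" for k by (metis diff_add_cancel)
  ultimately have "u (k + int (nat \<bar>j\<bar>)) = u k" for k
    by (cases "j \<ge> 0") auto
  moreover have "nat \<bar>j\<bar> \<ge> 1" using \<open>j \<noteq> 0\<close> by simp
  ultimately show False using aperiodic unfolding periodic_seq_def by blast
qed

text \<open>If every \<open>ps k\<close>-periodic symbol reappeared periodically at offset \<open>r\<close>, the positions
  would already be periodic for \<open>gcd r (ps k) < ps k\<close>, contradicting essentiality.\<close>

lemma offset_mismatch:
  assumes r: "\<not> int (ps k) dvd r"
  shows "\<exists>i\<in>per (ps k) u. \<exists>m. u (i + r + int (ps k) * m) \<noteq> u i"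
proof (rule ccontr)
  let ?p = "int (ps k)"
  assume "\<not> ?thesis"
  then have *: "u (i + r + ?p * m) = u i" if "i \<in> per (ps k) u" for i m
    using that by blast
  have shift: "i + r \<in> per (ps k) u" if "i \<in> per (ps k) u" for i
    using *[OF that] *[OF that, of 0] unfolding per_def by simp
  have iter: "i + int n * r \<in> per (ps k) u \<and> u (i + int n * r) = u i" if "i \<in> per (ps k) u" for i n
  proof (induction n)
    case (Suc n)
    then show ?case
      using shift[of "i + int n * r"] *[of "i + int n * r" 0] by (simp add: algebra_simps)
  qed (use that in simp)
  define q where "q = nat (gcd r ?p)"
  have q: "int q = gcd r ?p" "q \<ge> 1" "q < ps k" 
  proof -
    show "int q = gcd r ?p" unfolding q_def by simp
    have p0: "?p > 0" using ps_pos by simp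
    show "q \<ge> 1" using p0 unfolding q_def by (metis One_nat_def Suc_leI gcd_pos_int less_irrefl zero_less_nat_eq)
    have "gcd r ?p \<le> ?p" using p0 by (simp add: gcd_le2_int)
    moreover have "gcd r ?p \<noteq> ?p" using r by (metis gcd_dvd1)
    ultimately have "gcd r ?p < ?p" by linarith
    then show "q < ps k" unfolding q_def by (simp add: nat_less_iff)
  qed
  have "i \<in> per q u" if i: "i \<in> per (ps k) u" for i
    unfolding per_def
  proof (intro CollectI allI)
    fix m
    obtain a b where ab: "a * r + b * ?p = gcd r ?p" using bezout_int by blast
    \<comment> \<open>Only nonnegative multiples of \<open>r\<close> were iterated, so the Bezout
      multiplier \<open>a * m\<close> is replaced by its residue \<open>n\<close>; then
      \<open>i + int n * r\<close> and \<open>i + int q * m\<close> are congruent modulo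
      \<open>?p\<close>.\<close>
    define n where "n = nat (a * m mod ?p)"
    have "int n = a * m mod ?p" using ps_pos[of k] by (simp add: n_def)
    then have "?p dvd a * m - int n" by (metis dvd_minus_mod)
    then have "?p dvd (a * m - int n) * r + ?p * (b * m)" by simp
    moreover have "(a * m - int n) * r + ?p * (b * m) = (i + int q * m) - (i + int n * r)"
      unfolding q(1) ab[symmetric] by (simp add: algebra_simps)
    ultimately have "?p dvd (i + int n * r) - (i + int q * m)"
      by (metis dvd_minus_iff minus_diff_eq)
    then show "u i = u (i + int q * m)"
      using iter[OF i, of n] per_dest by metis
  qed
  moreover have "per q u \<subseteq> per (ps k) u"
    using q(1) per_mono[of q "ps k"] by (metis gcd_dvd2 int_dvd_int_iff)
  ultimately have "per q u = per (ps k) u" by blast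
  then show False
    using scale q(2,3) unfolding period_structure_def essential_def by blast
qed

text \<open>For each nonzero residue \<open>r\<close> of \<open>j - i\<close>, the mismatch from
  \<open>offset_mismatch\<close> recurs with some period \<open>N r\<close>, so every window of that
  length shows it. There are only finitely many residues, so one window excludes them all.\<close>

lemma window:
  "\<exists>L. \<forall>i j. agree L (orb i) (orb j) \<longrightarrow> i mod int (ps k) = j mod int (ps k)"
proof -
  let ?p = "int (ps k)"
  have p0: "?p > 0" using ps_pos by simp
  \<comment> \<open>Here \<open>i'\<close> is congruent to \<open>i + r\<close>, and
    \<open>n\<close> is a period of its symbol, so the mismatch with \<open>u i\<close> persists
    along the whole progression \<open>i' + int n * s\<close>.\<close>
  have "\<exists>i n. i \<in> per (ps k) u \<and> n > 0 \<and> (\<exists>i'. ?p dvd i' - i - r \<and> (\<forall>s. u (i' + int n * s) \<noteq> u i)) \<and> ps k dvd n"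
    if r: "\<not> ?p dvd r" for r
  proof -
    obtain i m where i: "i \<in> per (ps k) u" "u (i + r + ?p * m) \<noteq> u i"
      using offset_mismatch[OF r] by blast
    obtain l where l: "l \<ge> k" "i + r + ?p * m \<in> per (ps l) u" using covered by blast
    have "u (i + r + ?p * m + int (ps l) * s) \<noteq> u i" for s
      using l(2) i(2) unfolding per_def by auto
    moreover have "?p dvd i + r + ?p * m - i - r" by simp
    ultimately show ?thesis using i(1) ps_pos[of l] ps_dvd[OF l(1)] by blast
  qed
  then obtain I N where IN: "\<And>r. \<not> ?p dvd r \<Longrightarrow> I r \<in> per (ps k) u \<and> N r > 0 \<and>
      (\<exists>i'. ?p dvd i' - I r - r \<and> (\<forall>s. u (i' + int (N r) * s) \<noteq> u (I r))) \<and> ps k dvd N r"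
    by metis
  define L where "L = Max (insert 0 (N ` {0..<?p}))"
  have "i mod ?p = j mod ?p" if ag: "agree L (orb i) (orb j)" for i j
  proof (rule ccontr)
    assume neq: "i mod ?p \<noteq> j mod ?p"
    define r where "r = (j - i) mod ?p"
    have r: "r \<in> {0..<?p}" "\<not> ?p dvd r"
      using p0 neq by (auto simp: r_def dvd_mod_iff mod_eq_dvd_iff dvd_diff_commute)
    have NL: "N r \<le> L" unfolding L_def using r(1) by (intro Max_ge) auto
    obtain i' where i': "?p dvd i' - I r - r" "\<And>s. u (i' + int (N r) * s) \<noteq> u (I r)"
      and N: "N r > 0" "ps k dvd N r" and I: "I r \<in> per (ps k) u"
      using IN[OF r(2)] by blast
    \<comment> \<open>The offset is chosen so that \<open>j + l\<close> lies on the mismatching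
      progression; then \<open>i + l\<close> is congruent to \<open>I r\<close> modulo
      \<open>?p\<close>, and \<open>u\<close> differs at the two places.\<close>
    define l where "l = (i' - j) mod int (N r)"
    have l: "0 \<le> l" "l < int (N r)" using N(1) by (auto simp: l_def)
    have "\<bar>l\<bar> \<le> int L" using l NL by linarith
    then have "u (l + i) = u (l + j)"
      using ag unfolding agree_def translate_def by blast
    then have "u (i + l) = u (j + l)" by (simp add: add.commute)
    moreover have dl: "int (N r) dvd l - (i' - j)"
      unfolding l_def by (metis dvd_minus_mod dvd_minus_iff minus_diff_eq)
    then obtain s where "l - (i' - j) = int (N r) * s" by (elim dvdE)
    then have "j + l = i' + int (N r) * s" by simp
    then have "u (j + l) \<noteq> u (I r)" using i'(2) by simp
    moreover have "u (I r) = u (i + l)"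
    proof (rule per_dest[OF I])
      have "?p dvd l - (i' - j)" using dl N(2) by (meson dvd_trans int_dvd_int_iff)
      moreover have "?p dvd r - (j - i)"
        unfolding r_def by (metis dvd_minus_mod dvd_minus_iff minus_diff_eq)
      ultimately have "?p dvd - (i' - I r - r) - (l - (i' - j)) - (r - (j - i))"
        using i'(1) by (metis dvd_diff dvd_minus_iff)
      moreover have "- (i' - I r - r) - (l - (i' - j)) - (r - (j - i)) = I r - (i + l)"
        by simp
      ultimately show "?p dvd I r - (i + l)" by metis
    qed
    ultimately show False by simp
  qed
  then show ?thesis by blast
qed

section \<open>Phases: the coordinates of the odometer factor\<close>

definition W :: "nat \<Rightarrow> nat" where
  "W k = (SOME L. \<forall>i j. agree L (orb i) (orb j) \<longrightarrow> i mod int (ps k) = j mod int (ps k))"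

text \<open>The factor map onto the integers modulo \<open>ps k\<close>. Any orbit point that looks
  like \<open>x\<close> on the window \<open>W k\<close> gives the same residue, so the choice is
  immaterial and \<open>phase k\<close> is locally constant on \<open>X\<close>.\<close>

definition phase :: "nat \<Rightarrow> (int \<Rightarrow> 'a) \<Rightarrow> int" where
  "phase k x = (SOME j. agree (W k) x (orb j)) mod int (ps k)"

lemma phase_eq:
  assumes "agree (W k) x (orb j)"
  shows "phase k x = j mod int (ps k)"
proof -
  have "agree (W k) x (orb (SOME j. agree (W k) x (orb j)))"
    using assms by (rule someI)
  then have "agree (W k) (orb (SOME j. agree (W k) x (orb j))) (orb j)"
    using assms agree_sym agree_trans by metis
  moreover have "\<forall>i j. agree (W k) (orb i) (orb j) \<longrightarrow> i mod int (ps k) = j mod int (ps k)"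
    unfolding W_def using window by (rule someI_ex)
  ultimately show ?thesis unfolding phase_def by blast
qed

lemma phase_orb [simp]: "phase k (orb j) = j mod int (ps k)"
  by (rule phase_eq) simp

lemma phase_cong:
  assumes "agree (W k) x y" "y \<in> X"
  shows "phase k x = phase k y"
proof -
  obtain j where j: "agree (W k) y (orb j)" using approx[OF assms(2)] .
  show ?thesis using phase_eq[OF j] phase_eq[OF agree_trans[OF assms(1) j]] by simp
qed

lemma phase_translate:
  assumes "x \<in> X"
  shows "phase k (translate i x) = (phase k x + i) mod int (ps k)"
proof -
  obtain j where j: "agree (W k + nat \<bar>i\<bar>) x (orb j)" using approx[OF assms] .
  then have "phase k x = j mod int (ps k)" by (intro phase_eq) (rule agree_mono, auto)
  moreover have "phase k (translate i x) = (i + j) mod int (ps k)"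
    using agree_translate[OF j] by (intro phase_eq) simp
  ultimately show ?thesis by (simp add: mod_simps add.commute)
qed

lemma phase_mod:
  assumes "x \<in> X" "k \<le> m"
  shows "phase m x mod int (ps k) = phase k x"
proof -
  obtain j where j: "agree (max (W k) (W m)) x (orb j)" using approx[OF assms(1)] .
  then have "phase k x = j mod int (ps k)" "phase m x = j mod int (ps m)"
    by (auto intro!: phase_eq elim: agree_mono)
  then show ?thesis using ps_dvd[OF assms(2)] by (simp add: mod_mod_cancel)
qed

lemma phase_bounds: "0 \<le> phase k x" "phase k x < int (ps k)"
  using ps_pos[of k] by (simp_all add: phase_def)

lemma phase_mod_self [simp]: "phase k x mod int (ps k) = phase k x"
  using phase_bounds by simp

text \<open>The odometer factor is injective over the orbit of \<open>u\<close>: at a level where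
  the position \<open>l + i\<close> is periodic, the phase determines the symbol. Over other points
  the fibre may be larger, hence the detours through orbit points below.\<close>

lemma phase_eq_orb:
  assumes x: "x \<in> X" and ph: "\<And>k. phase k x = phase k (orb i)"
  shows "x = orb i"
proof
  fix l
  obtain k where k: "l + i \<in> per (ps k) u" using covered by blast
  obtain j where j: "agree (max (W k) (nat \<bar>l\<bar>)) x (orb j)" using approx[OF x] .
  then have "agree (W k) x (orb j)" by (rule agree_mono) simp
  then have "i mod int (ps k) = j mod int (ps k)" using phase_eq ph[of k] by simp
  then have "int (ps k) dvd (l + i) - (l + j)" by (simp add: mod_eq_dvd_iff)
  from per_dest[OF k this] have "u (l + i) = u (l + j)" .
  moreover have "x l = orb j l" using j unfolding agree_def by (simp add: max_def split: if_splits)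
  ultimately show "x l = orb i l" by (simp add: translate_def)
qed

lemma phase_orb_eqI:
  assumes "x \<in> X" "\<And>k. \<exists>m\<ge>k. phase m x = phase m (orb i)"
  shows "x = orb i"
proof (rule phase_eq_orb[OF assms(1)])
  fix k
  obtain m where "m \<ge> k" "phase m x = phase m (orb i)" using assms(2) by blast
  then show "phase k x = phase k (orb i)" using phase_mod[OF assms(1), of k m] phase_mod[of "orb i" k m] by simp
qed

text \<open>Continuity and density of the orbit. Equality is only demanded on the window
  \<open>W k\<close> around \<open>x\<close>, so that it may be checked within a single phase
  class.\<close>

lemma orb_dense:
  assumes x: "x \<in> X" and f: "inverse_pair X f f'" and eq: "\<And>j. agree (W k) x (orb j) \<Longrightarrow> f (orb j) = g (orb j)"
    and g: "inverse_pair X g g'"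
  shows "f x = g x"
proof (rule agree_all_imp_eq)
  fix L
  obtain M where M: "\<forall>y\<in>X. agree M x y \<longrightarrow> agree L (f x) (f y)"
    using f x unfolding inverse_pair_def pointwise_cont_def by blast
  obtain M' where M': "\<forall>y\<in>X. agree M' x y \<longrightarrow> agree L (g x) (g y)"
    using g x unfolding inverse_pair_def pointwise_cont_def by blast
  obtain j where "agree (max (W k) (max M M')) x (orb j)" using approx[OF x] .
  then have j: "agree (W k) x (orb j)" "agree M x (orb j)" "agree M' x (orb j)"
    by (auto elim: agree_mono)
  then show "agree L (f x) (g x)"
    using M M' eq[OF j(1)] orb_mem agree_sym agree_trans by metis
qed

section \<open>Automorphisms acting on the odometer\<close>

lemma eq_on_orbit_imp_eq:
  assumes f: "f \<in> Aut_inf X" and g: "g \<in> Aut_inf X" and "\<And>j. f (orb j) = g (orb j)"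
  shows "f = g"
proof
  fix x
  obtain m n where f: "f \<in> Aut X (shift ^^ m)" and g: "g \<in> Aut X (shift ^^ n)"
    using f g by (metis Aut_infE)
  obtain f' g' where "inverse_pair X f f'" "inverse_pair X g g'"
    using f g unfolding Aut_iff by blast
  then show "f x = g x"
    using orb_dense[of x f f' 0 g g'] assms(3) f g unfolding Aut_iff by metis
qed

lemma approx_map:
  assumes "x \<in> X" "inverse_pair X f f'"
  obtains j where "agree L x (orb j)" "agree L' (f x) (f (orb j))"
proof -
  obtain M where M: "\<forall>y\<in>X. agree M x y \<longrightarrow> agree L' (f x) (f y)"
    using assms unfolding inverse_pair_def pointwise_cont_def by blast
  obtain j where j: "agree (max L M) x (orb j)" using approx[OF assms(1)] .
  have "agree L x (orb j)" "agree M x (orb j)" using j by (auto elim: agree_mono)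
  then show ?thesis using that M orb_mem by blast
qed

text \<open>The numbers \<open>gcd N (ps m)\<close> form a divisibility chain bounded by
  \<open>N\<close>; from the index of a largest one on, they are constant.\<close>

lemma gcd_stabilizes:
  assumes "N \<ge> 1"
  shows "\<exists>K. \<forall>m. gcd N (ps m) dvd ps K"
proof -
  have "gcd N (ps m) < Suc N" for m
    using assms by (simp add: less_Suc_eq_le gcd_le1_nat)
  then obtain K where K: "\<And>m. gcd N (ps m) \<le> gcd N (ps K)"
    using ex_has_greatest_nat[of "\<lambda>_. True" 0 "\<lambda>m. gcd N (ps m)" "Suc N"] by blast
  have "gcd N (ps m) dvd ps K" for m
  proof (cases "m \<le> K")
    case True
    then show ?thesis using ps_dvd by (meson dvd_trans gcd_dvd2)
  next
    case False
    then have "gcd N (ps K) dvd gcd N (ps m)"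
      using ps_dvd[of K m] by (auto intro: dvd_trans[OF gcd_dvd2])
    moreover have "gcd N (ps m) > 0" using assms by simp
    ultimately have "gcd N (ps m) = gcd N (ps K)"
      using K[of m] by (simp add: dvd_imp_le le_antisym)
    then show ?thesis by simp
  qed
  then show ?thesis by blast
qed

text \<open>The displacement of the phase along the orbit of \<open>u\<close> is \<open>N\<close>-periodic and, by regular
  recurrence of \<open>u\<close>, also \<open>ps m\<close>-periodic for some \<open>m\<close>, hence \<open>gcd N (ps m)\<close>-periodic; the
  level \<open>K\<close> only depends on \<open>N\<close>.\<close>

lemma local_translation:
  assumes N: "N \<ge> 1" and g: "g \<in> Aut X (shift ^^ N)"
  shows "\<exists>K. \<forall>k. \<forall>z\<in>X. \<forall>z'\<in>X. phase K z = phase K z' \<longrightarrow>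
    int (ps k) dvd (phase k (g z) - phase k z) - (phase k (g z') - phase k z')"
proof -
  obtain g' where g': "inverse_pair X g g'" using g unfolding Aut_iff by blast
  have gX: "g z \<in> X" if "z \<in> X" for z using inverse_pair_mem(1)[OF g' that] .
  obtain K where K: "\<And>m. gcd N (ps m) dvd ps K" using gcd_stabilizes[OF N] by blast
  define F where "F k j = (phase k (g (orb j)) - j) mod int (ps k)" for k j
  have F_N: "F k (j + int N * s) = F k j" for k j s
  proof -
    have "orb (j + int N * s) = translate (int N * s) (orb j)" by (simp add: add.commute)
    then have "g (orb (j + int N * s)) = translate (int N * s) (g (orb j))"
      using Aut_translate[OF g orb_mem] by simp
    then show ?thesis
      unfolding F_def using phase_translate[OF gX[OF orb_mem]] by (simp add: mod_simps)
  qed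
  have "\<exists>m. \<forall>s. F k (j + int (ps m) * s) = F k j" for k j
  proof -
    \<comment> \<open>Continuity at \<open>orb j\<close> looks at a finite window only, whose
      positions recur with a common period \<open>ps m\<close>. Taking \<open>m \<ge> k\<close>
      leaves the subtracted \<open>j\<close> unchanged modulo \<open>ps k\<close>.\<close>
    obtain L where L: "\<forall>y\<in>X. agree L (orb j) y \<longrightarrow> agree (W k) (g (orb j)) (g y)"
      using g' orb_mem[of j] unfolding inverse_pair_def pointwise_cont_def by blast
    obtain m where m: "m \<ge> k" "\<And>i. \<bar>i - j\<bar> \<le> int L \<Longrightarrow> i \<in> per (ps m) u"
      using covered_window by blast
    have "F k (j + int (ps m) * s) = F k j" for s
    proof -
      have "agree L (orb j) (orb (j + int (ps m) * s))"
        unfolding agree_def translate_def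
      proof (intro allI impI)
        fix l :: int assume "\<bar>l\<bar> \<le> int L"
        then have "l + j \<in> per (ps m) u" by (intro m(2)) simp
        then show "u (l + j) = u (l + (j + int (ps m) * s))" by (rule per_dest) simp
      qed
      then have "phase k (g (orb (j + int (ps m) * s))) = phase k (g (orb j))"
        using L phase_cong[of k] gX orb_mem by metis
      moreover have "int (ps k) dvd int (ps m) * s" using ps_dvd[OF m(1)] by simp
      ultimately show ?thesis
        unfolding F_def by (simp add: mod_eq_dvd_iff)
    qed
    then show ?thesis by blast
  qed
  then obtain m where m: "\<And>k j s. F k (j + int (ps (m k j)) * s) = F k j" by metis
  have F_K: "F k j = F k j'" if jj: "int (ps K) dvd j' - j" for k j j'
  proof -
    \<comment> \<open>The level \<open>m k j\<close> depends on \<open>j\<close>, but by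
      \<open>F_N\<close> only \<open>j mod int N\<close> matters, so a maximum over one residue
      system serves all \<open>j\<close>.\<close>
    define q where "q = Max (m k ` {0..<int N})"
    have F_q: "F k (j + int (ps q) * s) = F k j" for j s
    proof -
      define i where "i = j mod int N"
      have i: "i \<in> {0..<int N}" using N by (simp add: i_def)
      then have "m k i \<le> q" unfolding q_def by (intro Max_ge) auto
      then obtain e where e: "int (ps q) = int (ps (m k i)) * e"
        using ps_dvd by (metis dvdE of_nat_mult)
      have j: "j = i + int N * (j div int N)" by (simp add: i_def)
      have "F k (j + int (ps q) * s) = F k ((i + int (ps q) * s) + int N * (j div int N))"
        using j by (intro arg_cong[of _ _ "F k"]) linarith
      also have "\<dots> = F k (i + int (ps (m k i)) * (e * s))"
        unfolding F_N e by (simp add: mult.assoc)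
      also have "\<dots> = F k j"
        using m F_N[of k i "j div int N"] j by simp
      finally show ?thesis .
    qed
    obtain a b where ab: "a * int N + b * int (ps q) = gcd (int N) (int (ps q))" using bezout_int by blast
    have "gcd (int N) (int (ps q)) dvd j' - j"
      using K[of q] jj by (metis dvd_trans gcd_int_int_eq int_dvd_int_iff)
    then obtain c where c: "j' - j = gcd (int N) (int (ps q)) * c" by (elim dvdE)
    have "j' = (j + int (ps q) * (b * c)) + int N * (a * c)"
      using c unfolding ab[symmetric] by (simp add: algebra_simps)
    then show ?thesis using F_N F_q by metis
  qed
  have "int (ps k) dvd (phase k (g z) - phase k z) - (phase k (g z') - phase k z')"
    if z: "z \<in> X" "z' \<in> X" "phase K z = phase K z'" for k z z'
  proof -
    \<comment> \<open>A close enough orbit point shares the phases of \<open>z\<close> and the phase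
      of its image, which carries the result from \<open>F\<close> to all of
      \<open>X\<close>.\<close>
    have *: "\<exists>j. phase K z = j mod int (ps K) \<and> phase k z = j mod int (ps k) \<and> phase k (g z) = phase k (g (orb j))"
      if z: "z \<in> X" for z
    proof -
      obtain j where j: "agree (max (W K) (W k)) z (orb j)" "agree (W k) (g z) (g (orb j))"
        using approx_map[OF z g'] .
      have "agree (W K) z (orb j)" "agree (W k) z (orb j)" using j(1) by (auto elim: agree_mono)
      then show ?thesis using phase_eq phase_cong[OF j(2) gX[OF orb_mem]] by blast
    qed
    obtain j where j: "phase K z = j mod int (ps K)" "phase k z = j mod int (ps k)" "phase k (g z) = phase k (g (orb j))"
      using *[OF z(1)] by blast
    obtain j' where j': "phase K z' = j' mod int (ps K)" "phase k z' = j' mod int (ps k)" "phase k (g z') = phase k (g (orb j'))"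
      using *[OF z(2)] by blast
    have "F k j = F k j'"
      using j(1) j'(1) z(3) by (intro F_K) (simp add: mod_eq_dvd_iff[symmetric])
    then have "(phase k (g z) - phase k z) mod int (ps k) = (phase k (g z') - phase k z') mod int (ps k)"
      unfolding F_def j j' by (simp add: mod_simps)
    then show ?thesis by (simp add: mod_eq_dvd_iff)
  qed
  then show ?thesis by blast
qed

lemma phase_eq_iff_dvd: "phase k x = phase k y \<longleftrightarrow> int (ps k) dvd phase k x - phase k y"
  by (metis mod_eq_dvd_iff phase_mod_self)

section \<open>Maps that are a power of the shift on each phase class\<close>

definition pw :: "nat \<Rightarrow> (int \<Rightarrow> int) \<Rightarrow> (int \<Rightarrow> 'a) \<Rightarrow> (int \<Rightarrow> 'a)" where
  "pw k s x = (if x \<in> X then translate (s (phase k x)) x else x)"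

lemma pw_mem [simp]: "pw k s x \<in> X \<longleftrightarrow> x \<in> X"
  by (simp add: pw_def)

lemma pw_cont: "pointwise_cont X (pw k s)"
  unfolding pointwise_cont_def
proof (intro ballI allI)
  fix x L assume x: "x \<in> X"
  have "agree L (pw k s x) (pw k s y)"
    if y: "y \<in> X" and a: "agree (max (W k) (L + nat \<bar>s (phase k x)\<bar>)) x y" for y
  proof -
    have "agree (W k) x y" using a by (rule agree_mono) simp
    from phase_cong[OF this y] show ?thesis
      using agree_translate[OF agree_mono[OF a]] x y by (simp add: pw_def)
  qed
  then show "\<exists>M. \<forall>y\<in>X. agree M x y \<longrightarrow> agree L (pw k s x) (pw k s y)" by blast
qed

text \<open>\<open>s'\<close> is the translation table of the inverse map. Translating by
  \<open>ps k\<close> does not change the phase at level \<open>k\<close>, whence the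
  commutation.\<close>

lemma pw_Aut:
  assumes "\<And>i. 0 \<le> i \<Longrightarrow> i < int (ps k) \<Longrightarrow> s' ((i + s i) mod int (ps k)) = - s i"
    and "\<And>i. 0 \<le> i \<Longrightarrow> i < int (ps k) \<Longrightarrow> s ((i + s' i) mod int (ps k)) = - s' i"
  shows "pw k s \<in> Aut X (shift ^^ ps k)"
proof -
  have "pw k s' (pw k s x) = x" "pw k s (pw k s' x) = x" if "x \<in> X" for x
    using assms[OF phase_bounds, of x] that by (simp_all add: pw_def phase_translate)
  then have "inverse_pair X (pw k s) (pw k s')"
    unfolding inverse_pair_def by (simp add: pw_cont)
  then show ?thesis
    unfolding Aut_iff shift_funpow by (auto simp: pw_def phase_translate add.commute)
qed

lemma pw_Aut_inf:
  assumes "\<And>i. 0 \<le> i \<Longrightarrow> i < int (ps k) \<Longrightarrow> s' ((i + s i) mod int (ps k)) = - s i"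
    and "\<And>i. 0 \<le> i \<Longrightarrow> i < int (ps k) \<Longrightarrow> s ((i + s' i) mod int (ps k)) = - s' i"
  shows "pw k s \<in> Aut_inf X"
  using Aut_infI[OF _ pw_Aut[OF assms]] ps_pos[of k] by simp

text \<open>Such translations preserve every phase class of level \<open>k\<close>, so negating the
  table gives the inverse.\<close>

lemma pw_multiple_Aut_inf:
  assumes "\<And>i. int (ps k) dvd s i"
  shows "pw k s \<in> Aut_inf X"
proof (rule pw_Aut_inf[of k "\<lambda>i. - s i"])
  fix i assume i: "0 \<le> i" "i < int (ps k)"
  have "(i + s i) mod int (ps k) = i" "(i + - s i) mod int (ps k) = i"
    using i assms[of i] by (simp_all add: mod_eq_0_iff_dvd mod_add_eq[symmetric, of i] mod_diff_eq[symmetric, of i])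
  then show "- s ((i + s i) mod int (ps k)) = - s i" "s ((i + - s i) mod int (ps k)) = - (- s i)"
    by simp_all
qed

lemma Aut_inf_bij: "f \<in> Aut_inf X \<Longrightarrow> bij f"
proof -
  assume f: "f \<in> Aut_inf X"
  obtain f' where f': "f' \<in> Aut_inf X" "f' \<circ> f = id" using Aut_inf_inverse[OF f] by blast
  obtain f'' where "f'' \<in> Aut_inf X" "f'' \<circ> f' = id" using Aut_inf_inverse[OF f'(1)] by blast
  then have "f \<circ> f' = id" using f'(2) by (metis comp_assoc comp_id id_comp)
  then show "bij f" using f'(2) o_bij by blast
qed

lemma Aut_inf_mem: "f \<in> Aut_inf X \<Longrightarrow> f x \<in> X \<longleftrightarrow> x \<in> X"
  by (metis Aut_infE Aut_iff inverse_pair_mem(1))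

lemma Aut_inf_funpow: "f \<in> Aut_inf X \<Longrightarrow> f ^^ n \<in> Aut_inf X"
  by (induction n) (use Aut_inf_id in \<open>auto simp: id_def intro: Aut_inf_compose\<close>)

definition cent :: "((int \<Rightarrow> 'a) \<Rightarrow> (int \<Rightarrow> 'a)) \<Rightarrow> ((int \<Rightarrow> 'a) \<Rightarrow> (int \<Rightarrow> 'a)) set" where
  "cent g = {f \<in> Aut_inf X. f \<circ> g = g \<circ> f}"

lemma has_free_torsion_Aut_inf:
  "has_free_torsion p (Aut_inf_group X) \<longleftrightarrow> (\<exists>g\<in>Aut_inf X. g \<noteq> id \<and> g ^^ p = id \<and>
     (\<forall>x\<in>cent g. \<forall>y\<in>cent g. x ^^ p \<noteq> id \<and> y ^^ p \<noteq> id \<longrightarrow>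
       (\<exists>h\<in>cent g. \<exists>t\<in>cent g. \<exists>c\<in>Aut_inf X. \<exists>d\<in>Aut_inf X.
          h \<circ> x \<circ> c = x \<circ> h \<and> d \<circ> t = t \<circ> c \<and> d \<circ> y \<noteq> y \<circ> d)))"
proof -
  have [simp]: "carrier (Aut_inf_group X) = Aut_inf X" "mult (Aut_inf_group X) = (\<circ>)" "one (Aut_inf_group X) = id"
    by (simp_all add: Aut_inf_group_def)
  have [simp]: "centr (Aut_inf_group X) g = cent g" for g
    by (simp add: centr_def cent_def)
  show ?thesis
    unfolding has_free_torsion_def Aut_inf_pow by simp
qed

section \<open>Elements of order not dividing the scale\<close>

text \<open>The set \<open>P\<close> is invariant under the centralizer, so the commutator
  \<open>c\<close> of \<open>x\<close> and its conjugate \<open>d\<close> act inside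
  \<open>P\<close> only, whereas \<open>y\<close> acts outside \<open>P\<close>. Maps with disjoint
  supports commute.\<close>

lemma commutator_supports_disjoint:
  assumes P: "\<And>f z. f \<in> cent g \<Longrightarrow> P (f z) \<longleftrightarrow> P z"
    and x: "x \<in> Aut_inf X" "\<And>z. \<not> P z \<Longrightarrow> x z = z"
    and y: "y \<in> cent g" "\<And>z. P z \<Longrightarrow> y z = z"
    and h: "h \<in> cent g" and t: "t \<in> cent g" and d: "d \<in> Aut_inf X"
    and c: "h \<circ> x \<circ> c = x \<circ> h" and dt: "d \<circ> t = t \<circ> c"
  shows "d \<circ> y = y \<circ> d"
proof -
  have inj: "inj x" "inj h" "inj d" and surj: "surj t"
    using x(1) h t d by (simp_all add: cent_def bij_is_inj[OF Aut_inf_bij] bij_is_surj[OF Aut_inf_bij])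
  have c_id: "c z = z" if z: "\<not> P z" for z
  proof -
    have "h (x (c z)) = h z"
      using fun_cong[OF c, of z] x(2) z P[OF h] by simp
    then have "x (c z) = x z" using inj(2) x(2)[OF z] by (simp add: inj_eq)
    then show ?thesis using inj(1) by (simp add: inj_eq)
  qed
  have d_id: "d w = w" if w: "\<not> P w" for w
  proof -
    obtain z where "w = t z" using surj by (metis surjD)
    then show ?thesis using fun_cong[OF dt, of z] c_id[of z] w P[OF t] by simp
  qed
  have "d (y w) = y (d w)" for w
  proof (cases "P w")
    case True
    \<comment> \<open>If \<open>d w\<close> were outside \<open>P\<close>, then \<open>d\<close>
      would fix it, and injectivity would give \<open>d w = w\<close>.\<close>
    then have "P (d w)" using d_id inj(3) by (metis inj_eq)
    then show ?thesis using y(2) True by simp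
  next
    case False
    then show ?thesis using d_id P[OF y(1)] by simp
  qed
  then show ?thesis by (simp add: fun_eq_iff)
qed

text \<open>For any candidate \<open>g\<close>, the maps \<open>x\<close> and \<open>y\<close> below
  are powers of the shift on the fixed points of \<open>g\<close> and off them, and
  \<open>commutator_supports_disjoint\<close> refutes the required condition.\<close>

lemma no_free_torsion:
  assumes p: "prime p" and ndvd: "\<And>k. \<not> p dvd ps k"
  shows "\<not> has_free_torsion p (Aut_inf_group X)"
proof
  assume "has_free_torsion p (Aut_inf_group X)"
  then obtain g where g: "g \<in> Aut_inf X" "g \<noteq> id" "g ^^ p = id"
    and *: "\<And>x y. x \<in> cent g \<Longrightarrow> y \<in> cent g \<Longrightarrow> x ^^ p \<noteq> id \<Longrightarrow> y ^^ p \<noteq> id \<Longrightarrow>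
       \<exists>h\<in>cent g. \<exists>t\<in>cent g. \<exists>c\<in>Aut_inf X. \<exists>d\<in>Aut_inf X.
          h \<circ> x \<circ> c = x \<circ> h \<and> d \<circ> t = t \<circ> c \<and> d \<circ> y \<noteq> y \<circ> d"
    unfolding has_free_torsion_Aut_inf by blast
  obtain N where N: "N \<ge> 1" "g \<in> Aut X (shift ^^ N)" using g(1) by (rule Aut_infE)
  obtain g' where g': "inverse_pair X g g'" using N(2) unfolding Aut_iff by blast
  obtain K where K: "\<And>k z z'. z \<in> X \<Longrightarrow> z' \<in> X \<Longrightarrow> phase K z = phase K z' \<Longrightarrow>
    int (ps k) dvd (phase k (g z) - phase k z) - (phase k (g z') - phase k z')"
    using local_translation[OF N] by blast
  have gX: "g z \<in> X" if "z \<in> X" for z using inverse_pair_mem(1)[OF g' that] .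
  have giX: "(g ^^ i) z \<in> X" if "z \<in> X" for i z using that gX by (induction i) auto
  have gp: "(g ^^ p) z = z" for z using g(3) by simp
  have phase_fix: "phase K (g w) = phase K w"
    if "z \<in> X" "w \<in> X" "phase K (g z) = phase K z" "phase K w = phase K z" for z w
    using K[OF that(2,1,4), of K] that(3) by (simp add: phase_eq_iff_dvd[of K "g w" w])
  \<comment> \<open>The iterates of \<open>z\<close> under \<open>g\<close> keep the phase at level
    \<open>K\<close>, so each step adds the same \<open>c\<close> to the phase at level
    \<open>k\<close>. After \<open>p\<close> steps, \<open>p * c\<close> vanishes modulo
    \<open>ps k\<close>, and \<open>p\<close> can be cancelled.\<close>
  have fix_orb: "g z = z" if z: "z \<in> X" "phase K (g z) = phase K z" "z = orb j" for z j
  proof -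
    have "phase k (g z) = phase k z" for k
    proof -
      define c where "c = phase k (g z) - phase k z"
      have "phase K ((g ^^ i) z) = phase K z" for i
        by (induction i) (use phase_fix[OF z(1) giX z(2)] z(1) in auto)
      then have step: "int (ps k) dvd phase k (g ((g ^^ i) z)) - phase k ((g ^^ i) z) - c" for i
        unfolding c_def using K[OF giX[OF z(1)] z(1)] by blast
      have "int (ps k) dvd phase k ((g ^^ i) z) - phase k z - int i * c" for i
      proof (induction i)
        case (Suc i)
        have eq: "phase k ((g ^^ Suc i) z) - phase k z - int (Suc i) * c =
          (phase k (g ((g ^^ i) z)) - phase k ((g ^^ i) z) - c) + (phase k ((g ^^ i) z) - phase k z - int i * c)"
          by (simp add: algebra_simps)
        show ?case unfolding eq by (rule dvd_add[OF step Suc])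
      qed simp
      from this[of p] have "int (ps k) dvd int p * c" by (simp add: gp)
      moreover have "coprime (int (ps k)) (int p)"
        using p ndvd[of k] by (metis coprime_commute coprime_int_iff prime_imp_coprime)
      ultimately have "int (ps k) dvd c" by (simp add: coprime_dvd_mult_right_iff)
      then show ?thesis unfolding c_def phase_eq_iff_dvd .
    qed
    then show ?thesis using phase_eq_orb[OF gX[OF z(1)], of j] z(3) by simp
  qed
  \<comment> \<open>Phases separate orbit points only, so a general \<open>z\<close> is approximated
    by orbit points of the same phase at level \<open>K\<close>.\<close>
  have fixed: "g z = z" if z: "z \<in> X" "phase K (g z) = phase K z" for z
  proof -
    have "g (orb j) = id (orb j)" if a: "agree (W K) z (orb j)" for j
      using fix_orb[OF orb_mem _ refl] phase_fix[OF z(1) orb_mem z(2)] phase_cong[OF a orb_mem] by simp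
    then have "g z = id z"
      by (rule orb_dense[OF z(1) g', of K id id]) (auto simp: inverse_pair_def pointwise_cont_def)
    then show ?thesis by simp
  qed
  \<comment> \<open>The permutation that \<open>g\<close> induces on the phase classes of level
    \<open>K\<close>.\<close>
  define \<pi> where "\<pi> i = phase K (g (orb i))" for i
  have \<pi>: "phase K (g z) = \<pi> (phase K z)" if "z \<in> X" for z
    using K[OF that orb_mem, of "phase K z" K] unfolding \<pi>_def by (simp add: phase_eq_iff_dvd)
  have \<pi>_pow: "(\<pi> ^^ j) i = phase K ((g ^^ j) (orb i))" if "i \<in> {0..<int (ps K)}" for i j
    using that by (induction j) (simp_all add: \<pi> giX)
  have "\<exists>i\<in>{0..<int (ps K)}. \<pi> i = i"
  proof (rule prime_order_fixed_point[OF p])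
    show "\<pi> ` {0..<int (ps K)} \<subseteq> {0..<int (ps K)}"
      using phase_bounds by (auto simp: \<pi>_def)
    show "(\<pi> ^^ p) i = i" if "i \<in> {0..<int (ps K)}" for i
      using that by (simp add: \<pi>_pow gp)
  qed (use ndvd in simp_all)
  then obtain i0 where i0: "0 \<le> i0" "i0 < int (ps K)" "\<pi> i0 = i0" by auto
  \<comment> \<open>Hence the fixed point set is a union of phase classes, and maps supported on it
    or off it can be written with \<open>pw\<close>.\<close>
  have P_iff: "g z = z \<longleftrightarrow> \<pi> (phase K z) = phase K z" if "z \<in> X" for z
    using fixed[OF that] \<pi>[OF that] by auto
  define P where "P z \<longleftrightarrow> z \<in> X \<and> g z = z" for z
  have P_cent: "P (f z) \<longleftrightarrow> P z" if "f \<in> cent g" for f z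
  proof -
    have f: "f \<in> Aut_inf X" "f (g z) = g (f z)" using that by (auto simp: cent_def fun_eq_iff)
    show ?thesis
      unfolding P_def using f(2) Aut_inf_mem[OF f(1)] bij_is_inj[OF Aut_inf_bij[OF f(1)]] by (metis inj_eq)
  qed
  \<comment> \<open>The factor \<open>ps K\<close> keeps the phase classes in place, and
    \<open>N\<close> makes the translation commute with \<open>g\<close>.\<close>
  define M where "M = int (ps K) * int N"
  have M0: "M \<noteq> 0" using N(1) ps_pos[of K] by (simp add: M_def)
  have gT: "g (translate M z) = translate M (g z)" if "z \<in> X" for z
    by (rule Aut_translate[OF N(2) that]) (simp add: M_def)
  have P_T: "P (translate M z) \<longleftrightarrow> P z" for z
    unfolding P_def using gT[of z] by (metis translate_mem_orbit_closure_iff translate_eq_iff)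
  have P_orb: "P (orb (M + j)) \<longleftrightarrow> P (orb j)" for j
    using P_T[of "orb j"] by simp
  define x where "x = pw K (\<lambda>i. if \<pi> i = i then M else 0)"
  define y where "y = pw K (\<lambda>i. if \<pi> i = i then 0 else M)"
  have x_eq: "x z = (if P z then translate M z else z)" for z
    unfolding x_def pw_def P_def using P_iff[of z] by (cases "z \<in> X") auto
  have y_eq: "y z = (if P z \<or> z \<notin> X then z else translate M z)" for z
    unfolding y_def pw_def P_def using P_iff[of z] by (cases "z \<in> X") auto
  have gP: "P (g z) \<longleftrightarrow> P z" for z
    by (rule P_cent) (simp add: cent_def g(1))
  have xA: "x \<in> Aut_inf X" and yA: "y \<in> Aut_inf X"
    unfolding x_def y_def by (rule pw_multiple_Aut_inf, simp add: M_def)+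
  have "x (g z) = g (x z)" for z
    unfolding x_eq gP using gT[of z] by (auto simp: P_def)
  then have x: "x \<in> cent g" using xA by (simp add: cent_def fun_eq_iff)
  have "y (g z) = g (y z)" for z
    unfolding y_eq gP using gT[of z] Aut_inf_mem[OF g(1)] by auto
  then have y: "y \<in> cent g" using yA by (simp add: cent_def fun_eq_iff)
  have pM: "int p * M \<noteq> 0" using M0 p by (simp add: prime_gt_0_nat)
  have "P (orb i0)"
    unfolding P_def using P_iff[of "orb i0"] i0 by simp
  then have "(x ^^ n) (orb i0) = translate (int n * M) (orb i0) \<and> P ((x ^^ n) (orb i0))" for n
    by (induction n) (auto simp: x_eq P_orb algebra_simps)
  then have "(x ^^ p) (orb i0) \<noteq> orb i0" using orb_aperiodic pM by metis
  then have xp: "x ^^ p \<noteq> id" by auto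
  \<comment> \<open>As \<open>g\<close> differs from the identity, it already moves a point of the
    orbit of \<open>u\<close>, where aperiodicity is available.\<close>
  obtain j0 where "\<not> P (orb j0)"
    using eq_on_orbit_imp_eq[OF g(1) Aut_inf_id] g(2) unfolding P_def by auto
  then have "(y ^^ n) (orb j0) = translate (int n * M) (orb j0) \<and> \<not> P ((y ^^ n) (orb j0))" for n
    by (induction n) (auto simp: y_eq P_orb algebra_simps)
  then have "(y ^^ p) (orb j0) \<noteq> orb j0" using orb_aperiodic pM by metis
  then have yp: "y ^^ p \<noteq> id" by auto
  obtain h t c d where "h \<in> cent g" "t \<in> cent g" "c \<in> Aut_inf X" "d \<in> Aut_inf X"
    "h \<circ> x \<circ> c = x \<circ> h" "d \<circ> t = t \<circ> c" "d \<circ> y \<noteq> y \<circ> d"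
    using *[OF x y xp yp] by (elim bexE conjE) (rule that; assumption)
  moreover have "x z = z" if "\<not> P z" for z using that by (simp add: x_eq)
  moreover have "y z = z" if "P z" for z using that by (simp add: y_eq)
  ultimately show False
    using commutator_supports_disjoint[of g P x y h t d c] P_cent xA y by blast
qed

end

section \<open>Free elements of order dividing the scale\<close>

locale rotation = aperiodic_toeplitz u ps for u :: "int \<Rightarrow> 'a" and ps +
  fixes p k0 :: nat
  assumes p_ge: "p \<ge> 2" and p_dvd: "p dvd ps k0"
begin

definition r :: "(int \<Rightarrow> 'a) \<Rightarrow> int" where
  "r z = phase k0 z mod int p"

text \<open>Since \<open>r (translate j z) = r z + j\<close> modulo \<open>p\<close>, the map \<open>rot\<close> permutes cyclically
  the translates \<open>base z, \<dots>, translate (p - 1) (base z)\<close>.\<close>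

definition rot :: "(int \<Rightarrow> 'a) \<Rightarrow> (int \<Rightarrow> 'a)" where
  "rot = pw k0 (\<lambda>i. if i mod int p = int p - 1 then 1 - int p else 1)"

text \<open>The member with residue \<open>0\<close> of the \<open>rot\<close>-cycle of
  \<open>z\<close>; it serves as a name for the cycle.\<close>

definition base :: "(int \<Rightarrow> 'a) \<Rightarrow> (int \<Rightarrow> 'a)" where
  "base z = translate (- r z) z"

text \<open>For \<open>k \<ge> k0\<close> this is the first of the \<open>p\<close> consecutive
  phases that form the block of \<open>phase k z\<close>, i.e. the phase in the quotient by
  \<open>rot\<close>.\<close>

abbreviation block :: "nat \<Rightarrow> (int \<Rightarrow> 'a) \<Rightarrow> int" where
  "block k z \<equiv> phase k (base z)"

lemma p_dvd_ps: "k0 \<le> k \<Longrightarrow> int p dvd int (ps k)"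
  using p_dvd ps_dvd dvd_trans int_dvd_int_iff by blast

lemma r_bounds: "0 \<le> r z" "r z < int p"
  using p_ge by (simp_all add: r_def)

lemma r_translate: "z \<in> X \<Longrightarrow> r (translate j z) = (r z + j) mod int p"
  unfolding r_def using p_dvd_ps[OF order_refl] by (simp add: phase_translate mod_mod_cancel mod_simps)

lemma r_translate_multiple: "z \<in> X \<Longrightarrow> int p dvd j \<Longrightarrow> r (translate j z) = r z"
  using r_bounds[of z] by (auto simp: r_translate elim!: dvdE)

lemma base_mem [simp]: "base z \<in> X \<longleftrightarrow> z \<in> X"
  by (simp add: base_def)

lemma r_base [simp]: "z \<in> X \<Longrightarrow> r (base z) = 0"
  by (simp add: base_def r_translate)

lemma base_translate_multiple:
  "z \<in> X \<Longrightarrow> int p dvd j \<Longrightarrow> base (translate j z) = translate j (base z)"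
  by (simp add: base_def r_translate_multiple add.commute)

lemma rot_eq:
  "rot z = (if z \<in> X then translate (if r z = int p - 1 then 1 - int p else 1) z else z)"
  by (simp add: rot_def pw_def r_def)

lemma rot_mem [simp]: "rot z \<in> X \<longleftrightarrow> z \<in> X"
  by (simp add: rot_def)

lemma r_rot: "z \<in> X \<Longrightarrow> r (rot z) = (if r z = int p - 1 then 0 else r z + 1)"
  using r_bounds[of z] p_ge by (auto simp: rot_eq r_translate)

lemma base_rot [simp]: "base (rot z) = base z"
proof (cases "z \<in> X")
  case True
  then show ?thesis
    unfolding base_def r_rot[OF True] by (auto simp: rot_eq)
next
  case False
  then show ?thesis by (simp add: rot_eq)
qed

lemma base_rot_funpow [simp]: "base ((rot ^^ n) z) = base z"
  by (induction n) auto

lemma rot_funpow_mem [simp]: "(rot ^^ n) z \<in> X \<longleftrightarrow> z \<in> X"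
  by (induction n) auto

lemma rot_funpow_translate:
  assumes "w \<in> X" "r w = 0"
  shows "n < p \<Longrightarrow> (rot ^^ n) w = translate (int n) w"
proof (induction n)
  case (Suc n)
  then have "r (translate (int n) w) = int n" using assms by (simp add: r_translate)
  then show ?case using Suc assms(1) by (simp add: rot_eq add.commute)
qed simp

lemma rot_funpow_base: "z \<in> X \<Longrightarrow> (rot ^^ nat (r z)) (base z) = z"
  using rot_funpow_translate[of "base z" "nat (r z)"] r_bounds[of z]
  by (simp add: base_def r_translate nat_less_iff)

text \<open>From the base point, \<open>p - 1\<close> steps forward are followed by one jump back by
  \<open>p - 1\<close>. Every other point of \<open>X\<close> is an iterate of its base
  point.\<close>

lemma rot_order: "rot ^^ p = id"
proof
  fix z
  show "(rot ^^ p) z = id z"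
  proof (cases "z \<in> X")
    case True
    let ?w = "base z"
    have w: "?w \<in> X" "r ?w = 0" using True by simp_all
    have "r (translate (int (p - 1)) ?w) = int (p - 1)"
      unfolding r_translate[OF w(1)] w(2) using p_ge by (simp del: of_nat_diff)
    then have rw: "r (translate (int (p - 1)) ?w) = int p - 1"
      using p_ge by (simp add: of_nat_diff)
    have "(rot ^^ p) ?w = rot ((rot ^^ (p - 1)) ?w)"
      using p_ge by (metis Suc_diff_1 comp_apply funpow.simps(2) gr0I not_numeral_le_zero)
    also have "\<dots> = rot (translate (int (p - 1)) ?w)"
      using rot_funpow_translate[OF w, of "p - 1"] p_ge by simp
    also have "\<dots> = ?w"
      using rw w(1) p_ge by (simp add: rot_eq of_nat_diff)
    finally have "(rot ^^ p) ((rot ^^ nat (r z)) ?w) = (rot ^^ nat (r z)) ?w"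
      using fun_cong[OF funpow_add[of p "nat (r z)" rot], of ?w]
        fun_cong[OF funpow_add[of "nat (r z)" p rot], of ?w] by (simp add: add.commute)
    then show ?thesis using rot_funpow_base[OF True] by simp
  next
    case False
    then have "(rot ^^ n) z = z" for n by (induction n) (auto simp: rot_eq)
    then show ?thesis by simp
  qed
qed

lemma succ_mod_eq_0_iff: "(i + 1) mod int p = 0 \<longleftrightarrow> i mod int p = int p - 1"
proof -
  have "(i + 1) mod int p = (i mod int p + 1) mod int p" by (simp add: mod_simps)
  moreover have "0 \<le> i mod int p" "i mod int p < int p" using p_ge by simp_all
  ultimately show ?thesis
    by (cases "i mod int p = int p - 1") auto
qed

lemma rot_Aut_inf: "rot \<in> Aut_inf X"
  unfolding rot_def
\<comment> \<open>The inverse steps back by \<open>1\<close>, except at residue \<open>0\<close>,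
  where it jumps ahead by \<open>p - 1\<close>. Modulo \<open>p\<close> the two tables are just
  \<open>1\<close> and \<open>-1\<close>.\<close>
proof (rule pw_Aut_inf[of k0 "\<lambda>i. if i mod int p = 0 then int p - 1 else - 1"])
  note cancel = mod_mod_cancel[OF p_dvd_ps[OF order_refl]]
  fix i
  let ?s = "if i mod int p = int p - 1 then 1 - int p else 1"
    and ?s' = "if i mod int p = 0 then int p - 1 else - 1"
  have "(i + ?s) mod int (ps k0) mod int p = (i + 1) mod int p"
    unfolding cancel by (simp add: mod_eq_dvd_iff)
  then show "(if (i + ?s) mod int (ps k0) mod int p = 0 then int p - 1 else - 1) = - ?s"
    unfolding succ_mod_eq_0_iff[symmetric] by simp
  have "(i + ?s') mod int (ps k0) mod int p = (i - 1) mod int p"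
    unfolding cancel by (simp add: mod_eq_dvd_iff)
  then show "(if (i + ?s') mod int (ps k0) mod int p = int p - 1 then 1 - int p else 1) = - ?s'"
    using succ_mod_eq_0_iff[of "i - 1"] by simp
qed

lemma rot_neq_id: "rot \<noteq> id"
proof
  assume "rot = id"
  then have "rot (orb 0) = orb 0" by simp
  then show False
    using orb_aperiodic[of "1 - int p" 0] orb_aperiodic[of 1 0] p_ge by (auto simp: rot_eq split: if_splits)
qed

section \<open>The centralizer of the rotation\<close>

lemma cent_rot_funpow: "f \<in> cent rot \<Longrightarrow> f ((rot ^^ n) z) = (rot ^^ n) (f z)"
proof (induction n)
  case (Suc n)
  assume f: "f \<in> cent rot"
  have "f (rot w) = rot (f w)" for w
    using f unfolding cent_def by (metis (mono_tags, lifting) comp_apply mem_Collect_eq)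
  then show ?case using Suc f by simp
qed simp

lemma base_cent:
  assumes "f \<in> cent rot" "z \<in> X"
  shows "base (f z) = base (f (base z))"
  by (metis assms base_rot_funpow cent_rot_funpow rot_funpow_base)

lemma block_eq:
  assumes "k0 \<le> k" "z \<in> X"
  shows "block k z = phase k z - phase k z mod int p"
proof -
  have r: "r z = phase k z mod int p"
    unfolding r_def using phase_mod[OF assms(2,1)] by (metis mod_mod_cancel p_dvd_ps order_refl)
  have "0 \<le> phase k z - phase k z mod int p" "phase k z - phase k z mod int p < int (ps k)"
    using phase_bounds[of k z] p_ge zmod_le_nonneg_dividend[of "phase k z" "int p"]
      pos_mod_sign[of "int p" "phase k z"] by linarith+
  then show ?thesis
    unfolding base_def phase_translate[OF assms(2)] r by simp
qed

lemma block_multiple: "k0 \<le> k \<Longrightarrow> z \<in> X \<Longrightarrow> int p dvd block k z"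
  by (simp add: block_eq)

text \<open>Equal blocks mean equal phases of the base points. By \<open>local_translation\<close>
  their images have equal phases, and \<open>base_cent\<close> leads back to \<open>z\<close> and
  \<open>z'\<close>.\<close>

lemma cent_permutes_blocks:
  assumes f: "f \<in> cent rot"
  shows "\<exists>K. \<forall>k\<ge>K. \<forall>z\<in>X. \<forall>z'\<in>X. block k z = block k z' \<longrightarrow> block k (f z) = block k (f z')"
proof -
  have fA: "f \<in> Aut_inf X" using f by (simp add: cent_def)
  obtain N where "N \<ge> 1" "f \<in> Aut X (shift ^^ N)" using fA by (rule Aut_infE)
  then obtain K where K: "\<And>k z z'. z \<in> X \<Longrightarrow> z' \<in> X \<Longrightarrow> phase K z = phase K z' \<Longrightarrow>
    int (ps k) dvd (phase k (f z) - phase k z) - (phase k (f z') - phase k z')"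
    using local_translation by blast
  have "block k (f z) = block k (f z')"
    if k: "k \<ge> max K k0" and z: "z \<in> X" "z' \<in> X" "block k z = block k z'" for k z z'
  proof -
    have fz: "f (base z) \<in> X" "f (base z') \<in> X" using z Aut_inf_mem[OF fA] by simp_all
    have "phase K (base z) = phase K (base z')"
      using z k phase_mod[of "base z" K k] phase_mod[of "base z'" K k] by simp
    then have "phase k (f (base z)) = phase k (f (base z'))"
      using K[of "base z" "base z'" k] z by (simp add: phase_eq_iff_dvd)
    then have "block k (f (base z)) = block k (f (base z'))"
      using block_eq[of k] fz k by simp
    then show ?thesis using base_cent[OF f] z by metis
  qed
  then show ?thesis by blast
qed

text \<open>If \<open>f\<close> preserved the block of an orbit point at arbitrarily high levels, it
  would map this point into its own \<open>rot\<close>-cycle, hence act on it as a power of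
  \<open>rot\<close>, and \<open>f ^^ p\<close> would fix it.\<close>

lemma cent_moves_block:
  assumes f: "f \<in> cent rot" and fp: "f ^^ p \<noteq> id"
  shows "\<exists>j K. \<forall>k\<ge>K. block k (f (orb j)) \<noteq> block k (orb j)"
proof -
  have fA: "f \<in> Aut_inf X" using f by (simp add: cent_def)
  obtain j where j: "(f ^^ p) (orb j) \<noteq> orb j"
    using eq_on_orbit_imp_eq[OF Aut_inf_funpow[OF fA] Aut_inf_id] fp by auto
  let ?z = "orb j"
  have "\<exists>K. \<forall>k\<ge>K. block k (f ?z) \<noteq> block k ?z"
  proof (rule ccontr)
    assume "\<not> ?thesis"
    then have "\<And>K. \<exists>k\<ge>K. block k (f ?z) = phase k (orb (j - r ?z))"
      by (auto simp: base_def)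
    then have "base (f ?z) = orb (j - r ?z)"
      using Aut_inf_mem[OF fA] by (intro phase_orb_eqI) simp_all
    then have base_f: "base (f ?z) = base ?z" by (simp add: base_def)
    \<comment> \<open>Going from \<open>?z\<close> to its base takes \<open>p - b\<close> further
      rotations, and from there to \<open>f ?z\<close> another \<open>a\<close>.\<close>
    define a b where "a = nat (r (f ?z))" and "b = nat (r ?z)"
    have "b < p" using r_bounds[of ?z] by (simp add: b_def nat_less_iff)
    then have "(rot ^^ p) (base ?z) = (rot ^^ (p - b)) ((rot ^^ b) (base ?z))"
      using funpow_add[of "p - b" b rot] by simp
    then have "(rot ^^ (p - b)) ?z = (rot ^^ p) (base ?z)"
      using rot_funpow_base[OF orb_mem, of j] unfolding b_def by simp
    then have "(rot ^^ (p - b)) ?z = base ?z" by (simp add: rot_order)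
    then have "f ?z = (rot ^^ a) ((rot ^^ (p - b)) ?z)"
      using rot_funpow_base[of "f ?z"] Aut_inf_mem[OF fA] base_f by (simp add: a_def)
    then have fz: "f ?z = (rot ^^ (a + (p - b))) ?z" by (simp add: funpow_add)
    have "(f ^^ n) ?z = (rot ^^ (n * (a + (p - b)))) ?z" for n
    proof (induction n)
      case (Suc n)
      have "(f ^^ Suc n) ?z = f ((rot ^^ (n * (a + (p - b)))) ?z)" using Suc by simp
      also have "\<dots> = (rot ^^ (n * (a + (p - b)))) (f ?z)"
        by (rule cent_rot_funpow[OF f])
      also have "\<dots> = (rot ^^ (n * (a + (p - b)) + (a + (p - b)))) ?z"
        unfolding fz using funpow_add[of "n * (a + (p - b))" "a + (p - b)" rot] by simp
      finally show ?case by (simp add: add.commute)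
    qed simp
    then have "(f ^^ p) ?z = ((rot ^^ p) ^^ (a + (p - b))) ?z" by (simp add: funpow_mult mult.commute)
    then show False using j by (simp add: rot_order)
  qed
  then show ?thesis by blast
qed

text \<open>The translation depends on the \<open>rot\<close>-cycle only and, being by a multiple of
  \<open>p\<close>, preserves the residue \<open>r\<close> that governs \<open>rot\<close>.\<close>

lemma pw_block_cent:
  assumes k: "k0 \<le> k" and S: "\<And>i. int p dvd S i" and A: "pw k (\<lambda>i. S (i - i mod int p)) \<in> Aut_inf X"
  shows "pw k (\<lambda>i. S (i - i mod int p)) \<in> cent rot"
proof -
  let ?f = "pw k (\<lambda>i. S (i - i mod int p))"
  have f: "?f z = translate (S (block k z)) z" if "z \<in> X" for z
    using that k by (simp add: pw_def block_eq)
  have "?f (rot z) = rot (?f z)" for z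
  proof (cases "z \<in> X")
    case True
    have "?f (rot z) = translate (S (block k z)) (rot z)"
      using f[of "rot z"] True by simp
    also have "\<dots> = rot (translate (S (block k z)) z)"
      using True by (simp add: rot_eq r_translate_multiple[OF True S] add.commute)
    finally show ?thesis using f[OF True] by simp
  next
    case False
    then show ?thesis by (simp add: pw_def rot_eq)
  qed
  then show ?thesis using A by (simp add: cent_def fun_eq_iff)
qed

text \<open>The commutator \<open>c\<close> of \<open>x\<close> with the local shift \<open>h\<close> remembers a single block \<open>a\<close>, as the only
  one on which \<open>c\<close> is the shift by \<open>M > 0\<close>; an element commuting with the conjugate of \<open>c\<close> by a
  block permutation moving \<open>a\<close> to \<open>b\<close> therefore fixes the block \<open>b\<close>.\<close>

lemma commutator_detects_block:
  assumes x: "x \<in> cent rot" and xp: "x ^^ p \<noteq> id" and y: "y \<in> cent rot" and yp: "y ^^ p \<noteq> id"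
  shows "\<exists>h\<in>cent rot. \<exists>t\<in>cent rot. \<exists>c\<in>Aut_inf X. \<exists>d\<in>Aut_inf X.
    h \<circ> x \<circ> c = x \<circ> h \<and> d \<circ> t = t \<circ> c \<and> d \<circ> y \<noteq> y \<circ> d"
proof -
  have xA: "x \<in> Aut_inf X" and yA: "y \<in> Aut_inf X" using x y by (simp_all add: cent_def)
  obtain Nx where Nx: "Nx \<ge> 1" "x \<in> Aut X (shift ^^ Nx)" using xA by (rule Aut_infE)
  obtain Ny where Ny: "Ny \<ge> 1" "y \<in> Aut X (shift ^^ Ny)" using yA by (rule Aut_infE)
  obtain jx K1 where jx: "\<And>k. k \<ge> K1 \<Longrightarrow> block k (x (orb jx)) \<noteq> block k (orb jx)"
    using cent_moves_block[OF x xp] by blast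
  obtain jy K2 where jy: "\<And>k. k \<ge> K2 \<Longrightarrow> block k (y (orb jy)) \<noteq> block k (orb jy)"
    using cent_moves_block[OF y yp] by blast
  obtain K3 where K3: "\<And>k z z'. k \<ge> K3 \<Longrightarrow> z \<in> X \<Longrightarrow> z' \<in> X \<Longrightarrow> block k z = block k z' \<Longrightarrow> block k (x z) = block k (x z')"
    using cent_permutes_blocks[OF x] by blast
  define K where "K = max (max k0 K1) (max K2 K3)"
  have K: "k0 \<le> K" "K1 \<le> K" "K2 \<le> K" "K3 \<le> K" by (simp_all add: K_def)
  define n where "n = int (ps K)"
  \<comment> \<open>The factor \<open>n\<close> preserves blocks, while \<open>Nx\<close> and
    \<open>Ny\<close> make the translation commute with \<open>x\<close> and
    \<open>y\<close>.\<close>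
  define M where "M = n * (int Nx * int Ny)"
  have M0: "M \<noteq> 0" using ps_pos[of K] Nx(1) Ny(1) by (simp add: M_def n_def)
  have pn: "int p dvd n" unfolding n_def by (rule p_dvd_ps[OF K(1)])
  then have pM: "int p dvd M" unfolding M_def by simp
  have nM: "n dvd M" unfolding M_def by simp
  have xT: "x (translate M z) = translate M (x z)" "x (translate (- M) z) = translate (- M) (x z)" if "z \<in> X" for z
    using Aut_translate[OF Nx(2) that] by (simp_all add: M_def)
  have yT: "y (translate M z) = translate M (y z)" if "z \<in> X" for z
    using Aut_translate[OF Ny(2) that] by (simp add: M_def)
  \<comment> \<open>A block moved by \<open>x\<close>, and below one moved by \<open>y\<close>; the
    two may coincide.\<close>
  define a where "a = block K (orb jx)"
  define b where "b = block K (orb jy)"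
  have pab: "int p dvd a" "int p dvd b" and ab: "0 \<le> a" "a < n" "0 \<le> b" "b < n"
    using block_multiple[OF K(1)] phase_bounds[of K] by (simp_all add: a_def b_def n_def)
  have block_T: "block K (translate j z) = (block K z + j) mod n" if "z \<in> X" "int p dvd j" for z j
    using that by (simp add: base_translate_multiple phase_translate n_def)
  have block_M: "block K (translate M z) = block K z" "block K (translate (- M) z) = block K z" if "z \<in> X" for z
  proof -
    have "block K (translate e z) = block K z" if "n dvd e" "int p dvd e" for e
      unfolding block_T[OF \<open>z \<in> X\<close> that(2)] using that(1) phase_mod_self[of K "base z"]
      by (auto simp: n_def elim!: dvdE)
    then show "block K (translate M z) = block K z" "block K (translate (- M) z) = block K z"
      using nM pM by simp_all
  qed

  define hs where "hs q = (if q = a then M else 0)" for q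
  define h where "h = pw K (\<lambda>i. hs (i - i mod int p))"
  have h: "h z = (if block K z = a then translate M z else z)" if "z \<in> X" for z
    using that K(1) by (simp add: h_def hs_def pw_def block_eq)
  have hA: "h \<in> Aut_inf X"
    unfolding h_def by (rule pw_multiple_Aut_inf) (use nM in \<open>simp add: hs_def n_def\<close>)
  have hc: "h \<in> cent rot"
    using hA unfolding h_def by (intro pw_block_cent K) (simp_all add: hs_def pM)

  \<comment> \<open>Exchanges the blocks \<open>a\<close> and \<open>b\<close>, and is trivial if
    they are equal.\<close>
  define ts where "ts q = (if q = a then b - a else if q = b then a - b else 0)" for q
  define t where "t = pw K (\<lambda>i. ts (i - i mod int p))"
  have pts: "int p dvd ts q" for q using pab by (simp add: ts_def)
  have t: "t z = translate (ts (block K z)) z" if "z \<in> X" for z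
    using that K(1) by (simp add: t_def pw_def block_eq)
  have tinv: "ts ((i + ts (i - i mod int p)) mod n - (i + ts (i - i mod int p)) mod n mod int p) = - ts (i - i mod int p)"
    if i: "0 \<le> i" "i < n" for i
  proof -
    define q where "q = i - i mod int p"
    have iq: "(i + ts q) mod n mod int p = i mod int p"
      unfolding mod_mod_cancel[OF pn] using pts[of q] by (simp add: mod_eq_dvd_iff)
    \<comment> \<open>A block that starts below \<open>n\<close> also ends below \<open>n\<close>,
      both being multiples of \<open>p\<close>, so the exchange never wraps around modulo
      \<open>n\<close>.\<close>
    have bound: "e + i mod int p < n" if e: "int p dvd e" "e < n" for e
    proof -
      obtain e' where "e = int p * e'" using e(1) by (rule dvdE)
      moreover obtain n' where "n = int p * n'" using pn by (rule dvdE)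
      ultimately have e': "e = int p * e'" "n = int p * n'" by simp_all
      then have "e' + 1 \<le> n'" using e(2) p_ge by simp
      then have "int p * (e' + 1) \<le> int p * n'" by (intro mult_left_mono) simp_all
      moreover have "i mod int p < int p" using p_ge by simp
      ultimately show ?thesis unfolding e' by (simp add: algebra_simps)
    qed
    have im: "0 \<le> i mod int p" using p_ge by simp
    have "i + ts q = (if q = a then b else if q = b then a else q) + i mod int p"
      unfolding ts_def q_def by auto
    moreover have "(if q = a then b else if q = b then a else q) + i mod int p < n"
      using bound pab ab i unfolding q_def by (auto simp: q_def)
    moreover have "0 \<le> (if q = a then b else if q = b then a else q) + i mod int p"
      using im ab i unfolding q_def by auto
    ultimately have "(i + ts q) mod n = (if q = a then b else if q = b then a else q) + i mod int p"
      by simp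
    then have "(i + ts q) mod n - (i + ts q) mod n mod int p = (if q = a then b else if q = b then a else q)"
      unfolding iq by simp
    then show ?thesis unfolding q_def[symmetric] by (simp add: ts_def)
  qed
  have tA: "t \<in> Aut_inf X"
    unfolding t_def by (rule pw_Aut_inf) (use tinv in \<open>simp_all add: n_def\<close>)
  have tc: "t \<in> cent rot"
    using tA unfolding t_def by (intro pw_block_cent K pts)
  have block_t: "block K (t z) = b \<longleftrightarrow> block K z = a" if "z \<in> X" for z
    using phase_mod_self[of K "base z"] ab
    unfolding t[OF that] block_T[OF that pts] by (auto simp: ts_def n_def)
  have tT: "t (translate M z) = translate M (t z)" "t (translate (- M) z) = translate (- M) (t z)" if "z \<in> X" for z
    using that by (simp_all add: t block_M add.commute)

  obtain xi where xi: "xi \<in> Aut_inf X" "xi \<circ> x = id" using Aut_inf_inverse[OF xA] by blast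
  obtain hi where hi: "hi \<in> Aut_inf X" "hi \<circ> h = id" using Aut_inf_inverse[OF hA] by blast
  obtain ti where ti: "ti \<in> Aut_inf X" "ti \<circ> t = id" using Aut_inf_inverse[OF tA] by blast
  have xi_x: "xi (x z) = z" and hi_h: "hi (h z) = z" and ti_t: "ti (t z) = z" for z
    using xi(2) hi(2) ti(2) by (simp_all add: fun_eq_iff[of "_ \<circ> _"])
  have x_xi: "x (xi z) = z" and h_hi: "h (hi z) = z" and t_ti: "t (ti z) = z" for z
    using xi_x hi_h ti_t Aut_inf_bij[OF xA] Aut_inf_bij[OF hA] Aut_inf_bij[OF tA]
    by (metis bij_is_surj surjD)+
  define c where "c = xi \<circ> hi \<circ> x \<circ> h"
  define d where "d = t \<circ> c \<circ> ti"
  have cA: "c \<in> Aut_inf X"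
    unfolding c_def by (intro Aut_inf_compose xA hA xi hi)
  then have dA: "d \<in> Aut_inf X"
    unfolding d_def by (intro Aut_inf_compose tA ti)
  have hxc: "h \<circ> x \<circ> c = x \<circ> h" by (simp add: fun_eq_iff[of "_ \<circ> _"] c_def x_xi h_hi)
  have dt: "d \<circ> t = t \<circ> c" by (simp add: fun_eq_iff[of "_ \<circ> _"] d_def ti_t)

  \<comment> \<open>As \<open>x\<close> moves the block \<open>a\<close> off itself,
    \<open>hi\<close> acts trivially after \<open>x\<close>, and only the shift by \<open>h\<close>
    remains.\<close>
  have c_a: "c z = translate M z" if z: "z \<in> X" "block K z = a" for z
  proof -
    have "block K (x z) = block K (x (orb jx))" using K3[OF K(4) z(1) orb_mem] z(2) by (simp add: a_def)
    then have "block K (x z) \<noteq> a" using jx[OF K(2)] by (simp add: a_def)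
    then have "h (translate M (x z)) = translate M (x z)"
      using z Aut_inf_mem[OF xA] by (simp add: h block_M)
    then have "hi (translate M (x z)) = translate M (x z)" using hi_h by metis
    then show ?thesis
      using z by (simp add: c_def h xT(1)) (simp add: xi_x flip: xT(1))
  qed
  \<comment> \<open>Here \<open>h\<close> acts trivially, and \<open>hi\<close> contributes a shift
    by \<open>- M\<close> exactly on the block that \<open>x\<close> sends to
    \<open>a\<close>.\<close>
  have c_not_a: "c z = z \<or> c z = translate (- M) z" if z: "z \<in> X" "block K z \<noteq> a" for z
  proof (cases "block K (x z) = a")
    case True
    have xz: "x z \<in> X" using z(1) Aut_inf_mem[OF xA] by simp
    then have "h (translate (- M) (x z)) = x z"
      using True by (simp add: h block_M)
    then have "hi (x z) = x (translate (- M) z)" using hi_h xT(2)[OF z(1)] by metis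
    then show ?thesis using z by (simp add: c_def h xi_x)
  next
    case False
    have xz: "x z \<in> X" using z(1) Aut_inf_mem[OF xA] by simp
    then have "h (x z) = x z" using False by (simp add: h)
    then have "hi (x z) = x z" using hi_h by metis
    then show ?thesis using z by (simp add: c_def h xi_x)
  qed
  have d_b: "d w = translate M w" if w: "w \<in> X" "block K w = b" for w
  proof -
    have ti_w: "ti w \<in> X" using w(1) Aut_inf_mem[OF ti(1)] by simp
    then have "block K (ti w) = a" using block_t[OF ti_w] w(2) by (simp add: t_ti)
    then show ?thesis using ti_w by (simp add: d_def c_a tT t_ti)
  qed
  have d_not_b: "d w = w \<or> d w = translate (- M) w" if w: "w \<in> X" "block K w \<noteq> b" for w
  proof -
    have ti_w: "ti w \<in> X" using w(1) Aut_inf_mem[OF ti(1)] by simp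
    then have "block K (ti w) \<noteq> a" using block_t[OF ti_w] w(2) by (simp add: t_ti)
    from c_not_a[OF ti_w this] show ?thesis
      using ti_w by (auto simp: d_def tT t_ti)
  qed
  have "d \<circ> y \<noteq> y \<circ> d"
  proof
    assume "d \<circ> y = y \<circ> d"
    then have "d (y (orb jy)) = y (d (orb jy))" by (metis comp_apply)
    also have "\<dots> = translate M (y (orb jy))"
      using d_b[OF orb_mem] yT[OF orb_mem] by (simp add: b_def del: translate_translate)
    finally have d_y: "d (y (orb jy)) = translate M (y (orb jy))" .
    have yX: "y (orb jy) \<in> X" using Aut_inf_mem[OF yA] by simp
    have nb: "block K (y (orb jy)) \<noteq> b" using jy[OF K(3)] by (simp add: b_def)
    have inj: "inj y" using bij_is_inj[OF Aut_inf_bij[OF yA]] .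
    \<comment> \<open>A shift by \<open>M\<close> that equals the identity or the shift by
      \<open>- M\<close> at this point makes \<open>M\<close> or \<open>M + M\<close> a period,
      which pulls back along \<open>y\<close> to the aperiodic orbit.\<close>
    have "translate M (y (orb jy)) = y (orb jy) \<or> translate (M + M) (y (orb jy)) = y (orb jy)"
      using d_not_b[OF yX nb] unfolding d_y by (auto simp: translate_eq_iff)
    then have "y (translate M (orb jy)) = y (orb jy) \<or> y (translate (M + M) (orb jy)) = y (orb jy)"
      using yT[of "orb jy"] yT[of "translate M (orb jy)"] by (simp add: add.assoc)
    then show False
      using inj orb_aperiodic[of M jy] orb_aperiodic[of "M + M" jy] M0 by (auto dest: injD)
  qed
  then show ?thesis using hc tc cA dA hxc dt by blast
qed

lemma has_free_torsion: "has_free_torsion p (Aut_inf_group X)"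
  unfolding has_free_torsion_Aut_inf
  using rot_Aut_inf rot_neq_id rot_order commutator_detects_block by blast

end

section \<open>From the invariant to the valuations of the scale\<close>

lemma has_free_torsion_iff:
  assumes "\<not> periodic_seq u" "period_structure u ps" "prime p"
  shows "has_free_torsion p (Aut_inf_group (orbit_closure u)) \<longleftrightarrow> (\<exists>k. p dvd ps k)"
proof -
  interpret aperiodic_toeplitz u ps using assms(1,2) by unfold_locales
  have "has_free_torsion p (Aut_inf_group (orbit_closure u))" if "p dvd ps k" for k
  proof -
    interpret rotation u ps p k
      using that prime_ge_2_nat[OF assms(3)] by unfold_locales
    show ?thesis by (rule has_free_torsion)
  qed
  then show ?thesis using no_free_torsion[OF assms(3)] by blast
qed

lemma vp_eq_0_iff:
  assumes "period_structure u ps" "prime p"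
  shows "vp p ps = 0 \<longleftrightarrow> (\<forall>k. \<not> p dvd ps k)"
proof -
  have "ps k \<noteq> 0" for k
    using assms(1) unfolding period_structure_def by (metis not_one_le_zero)
  then have "multiplicity p (ps k) = 0 \<longleftrightarrow> \<not> p dvd ps k" for k
    using assms(2) by (metis multiplicity_eq_zero_iff not_prime_unit)
  moreover have "vp p ps = 0 \<longleftrightarrow> (\<forall>k. multiplicity p (ps k) = 0)"
    unfolding vp_def by (auto simp: SUP_eq_iff zero_enat_def bot_enat_def[symmetric] simp flip: bot_enat_def)
  ultimately show ?thesis by simp
qed

theorem theorem1p5:
  fixes u :: "int \<Rightarrow> 'a::finite" and w :: "int \<Rightarrow> 'b::finite"
    and ps qs :: "nat \<Rightarrow> nat"
  assumes "toeplitz u" and "\<not> periodic_seq u" and "period_structure u ps"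
    and "torsion_free_scale ps"
    and "toeplitz w" and "\<not> periodic_seq w" and "period_structure w qs"
    and "torsion_free_scale qs"
    and "Aut_inf_group (orbit_closure u) \<cong> Aut_inf_group (orbit_closure w)"
  shows "\<forall>p::nat. prime p \<longrightarrow> vp p ps = vp p qs"
proof (intro allI impI)
  fix p :: nat assume p: "prime p"
  obtain \<phi> where \<phi>: "\<phi> \<in> iso (Aut_inf_group (orbit_closure u)) (Aut_inf_group (orbit_closure w))"
    using assms(9) unfolding is_iso_def by blast
  note groups = group_Aut_inf_group[of u] group_Aut_inf_group[of w]
  have "has_free_torsion p (Aut_inf_group (orbit_closure u)) \<longleftrightarrow> has_free_torsion p (Aut_inf_group (orbit_closure w))"
    using has_free_torsion_iso[OF groups \<phi>] has_free_torsion_iso[OF groups(2,1) group.iso_set_sym[OF groups(1) \<phi>]]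
    by blast
  then have "vp p ps = 0 \<longleftrightarrow> vp p qs = 0"
    using has_free_torsion_iff[OF assms(2,3) p] has_free_torsion_iff[OF assms(6,7) p]
      vp_eq_0_iff[OF assms(3) p] vp_eq_0_iff[OF assms(7) p] by blast
  then show "vp p ps = vp p qs"
    using assms(4,8) p unfolding torsion_free_scale_def by metis
qed

end
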